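(* Fix $\tau$ in the upper half-plane and let $f(z|\tau)$ be an even entire function of $z$ satisfying $f(z|\tau)=f(z+\pi|\tau)=q^{4}e^{16iz} f(z+\pi\tau|\tau)$ for all $z$. Then, for all complex $x$ at which both sides are defined, \begin{align*} &(\log f)'(x|\tau)-4(\log \theta_1)'(2x|\tau)\\ &=\frac{\vartheta_1'(\tau)\theta_1^3(2x|\tau)}{4f(x|\tau)}\left(-\frac{f(0|\tau)}{\theta_1^4(x|\tau)}+\frac{f(\frac{\pi}{2}|\tau)}{\theta_2^4(x|\tau)}-\frac{qf(\frac{\pi+\pi\tau}{2}|\tau)}{\theta_3^4(x|\tau)}+\frac{qf(\frac{\pi\tau}{2}|\tau)}{\theta_4^4(x|\tau)}\right). \end{align*}
   Context: $q=e^{2\pi i\tau}$, $q^a=e^{2\pi i a\tau}$. Jacobi theta functions: $\theta_1(z|\tau)=2\sum_{n\ge0}(-1)^nq^{(2n+1)^2/8}\sin(2n+1)z$, $\theta_2(z|\tau)=2\sum_{n\ge0}q^{(2n+1)^2/8}\cos(2n+1)z$, $\theta_3(z|\tau)=1+2\sum_{n\ge1}q^{n^2/2}\cos 2nz$, $\theta_4(z|\tau)=1+2\sum_{n\ge1}(-1)^nq^{n^2/2}\cos 2nz$. $\vartheta_1'(\tau)$ is the $z$-derivative of $\theta_1(z|\tau)$ at $z=0$. Primes on $\log f$ and $\log\theta_1$ denote logarithmic derivatives with respect to the first variable. *)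

theory Defs
  imports "HOL-Complex_Analysis.Complex_Analysis"
begin

text \<open>
  The power \<open>q\<^sup>a\<close> is always read as \<open>e\<close> to the \<open>2\<pi>ia\<tau>\<close>; this fixes the branch for
  fractional \<open>a\<close>, so it is a function of \<open>\<tau>\<close> and not of the number \<open>q\<close>.
\<close>

definition qpow :: "complex \<Rightarrow> complex \<Rightarrow> complex" where
  "qpow \<tau> a = exp (2 * of_real pi * \<i> * a * \<tau>)"

definition theta1 :: "complex \<Rightarrow> complex \<Rightarrow> complex" where
  "theta1 z \<tau> =
     2 * (\<Sum>n. (-1) ^ n * qpow \<tau> ((2 * of_nat n + 1)\<^sup>2 / 8) * sin ((2 * of_nat n + 1) * z))"

definition theta2 :: "complex \<Rightarrow> complex \<Rightarrow> complex" where
  "theta2 z \<tau> =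
     2 * (\<Sum>n. qpow \<tau> ((2 * of_nat n + 1)\<^sup>2 / 8) * cos ((2 * of_nat n + 1) * z))"

text \<open>In the next two series the summation index is shifted to run over \<open>n \<ge> 1\<close>.\<close>

definition theta3 :: "complex \<Rightarrow> complex \<Rightarrow> complex" where
  "theta3 z \<tau> =
     1 + 2 * (\<Sum>n. qpow \<tau> ((of_nat (Suc n))\<^sup>2 / 2) * cos (2 * of_nat (Suc n) * z))"

definition theta4 :: "complex \<Rightarrow> complex \<Rightarrow> complex" where
  "theta4 z \<tau> =
     1 + 2 * (\<Sum>n. (-1) ^ Suc n * qpow \<tau> ((of_nat (Suc n))\<^sup>2 / 2) * cos (2 * of_nat (Suc n) * z))"

definition theta1_prime0 :: "complex \<Rightarrow> complex" where
  "theta1_prime0 \<tau> = deriv (\<lambda>z. theta1 z \<tau>) 0"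

text \<open>
  The logarithmic derivative \<open>(log g)'\<close>, meaningful only where \<open>g z \<noteq> 0\<close>; it does not depend on
  a branch of the logarithm.
\<close>

definition log_deriv :: "(complex \<Rightarrow> complex) \<Rightarrow> complex \<Rightarrow> complex" where
  "log_deriv g z = deriv g z / g z"

end

theory Submission
  imports Defs
begin

text \<open>
  The quotient \<open>g(z) = f(z) / \<theta>\<^sub>1(2z)\<^sup>2\<close> is an even elliptic function for the lattice
  \<open>\<pi>\<int> + \<pi>\<tau>\<int>\<close>, with at most double poles at the half periods, and the left-hand side of the
  theorem is \<open>g'/g\<close>. Likewise \<open>S(z) = \<theta>\<^sub>1(2z) / \<theta>\<^sub>1(z)\<^sup>4\<close> is odd and elliptic, with Laurent
  expansion \<open>2 / (\<theta>\<^sub>1'(0)\<^sup>3 z\<^sup>3) + O(z)\<close> at its only pole (up to a factor it is \<open>\<wp>'\<close>). Hence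
  subtracting suitable multiples of the translates of \<open>S\<close> by the four half periods from \<open>g'\<close>
  leaves an odd elliptic function without poles, which vanishes by Liouville's theorem. The
  four translates of \<open>S\<close> are \<open>\<plusminus>\<theta>\<^sub>1(2z) / \<theta>\<^sub>j(z)\<^sup>4\<close>.

  The zeros of \<open>\<theta>\<^sub>1\<close> are found by comparing it, again by Liouville's theorem, with the product
  \<open>e\<^sup>-\<^sup>i\<^sup>z Q(e\<^sup>2\<^sup>i\<^sup>z) Q(q e\<^sup>-\<^sup>2\<^sup>i\<^sup>z)\<close>, where \<open>Q(w) = \<Prod>k. 1 - q\<^sup>k w\<close>. The hypothesis
  \<open>\<theta>\<^sub>1(x) \<noteq> 0\<close> shows that the constant of proportionality is not zero.
\<close>

section \<open>Entire functions and removable singularities\<close>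

text \<open>Phrased by the ratios of consecutive coefficients because both series used below,
  Euler's and the partial theta series, have explicit ratios that tend to 0.\<close>

lemma summable_powser_entire:
  fixes c r :: "nat \<Rightarrow> complex"
  assumes c: "\<And>n. c (Suc n) = r n * c n" and r: "r \<longlonglongrightarrow> 0"
  shows "summable (\<lambda>n. c n * w ^ n)"
proof -
  have "(\<lambda>n. norm (r n) * norm w) \<longlonglongrightarrow> 0"
    using r by (intro tendsto_mult_left_zero tendsto_norm_zero)
  then have "eventually (\<lambda>n. norm (r n) * norm w < 1/2) sequentially"
    by (rule order_tendstoD) simp
  then obtain N where N: "\<And>n. n \<ge> N \<Longrightarrow> norm (r n) * norm w < 1/2"
    by (auto simp: eventually_sequentially)
  show ?thesis
  proof (rule summable_ratio_test[where c = "1/2" and N = N])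
    fix n assume "n \<ge> N"
    have "norm (c (Suc n) * w ^ Suc n) = (norm (r n) * norm w) * norm (c n * w ^ n)"
      by (simp add: c norm_mult mult_ac)
    also have "\<dots> \<le> 1/2 * norm (c n * w ^ n)"
      using N[OF \<open>n \<ge> N\<close>] by (intro mult_right_mono) auto
    finally show "norm (c (Suc n) * w ^ Suc n) \<le> 1/2 * norm (c n * w ^ n)" .
  qed simp
qed

lemma holomorphic_powser_entire:
  fixes c :: "nat \<Rightarrow> complex"
  assumes "\<And>w. summable (\<lambda>n. c n * w ^ n)"
  shows "(\<lambda>w. \<Sum>n. c n * w ^ n) holomorphic_on UNIV"
  using termdiffs_strong_converges_everywhere[OF assms]
  by (auto simp: holomorphic_on_def field_differentiable_def intro: has_field_derivative_at_within)

lemma entire_compose: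
  assumes "F holomorphic_on UNIV" "g holomorphic_on A"
  shows "(\<lambda>z. F (g z)) holomorphic_on A"
  using holomorphic_on_compose_gen[OF assms(2,1)] by (simp add: o_def)

lemma entire_has_deriv:
  assumes "F holomorphic_on UNIV"
  shows "(F has_field_derivative deriv F z) (at z)"
  using assms by (intro holomorphic_derivI[of F UNIV]) auto

lemma entire_divided_difference:
  fixes F :: "complex \<Rightarrow> complex"
  assumes "F holomorphic_on UNIV"
  obtains G where "G holomorphic_on UNIV" "\<And>z. F z = F 0 + z * G z"
  using pole_lemma[OF assms, of 0] by (intro that[of "\<lambda>z. if z = 0 then deriv F 0 else (F z - F 0) / (z - 0)"]) auto

lemma entire_odd_factor:
  fixes F :: "complex \<Rightarrow> complex"
  assumes "F holomorphic_on UNIV" and "\<And>z. F (- z) = - F z"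
  obtains G where "G holomorphic_on UNIV" "\<And>z. F z = z * G z" "\<And>z. G (- z) = G z"
proof -
  obtain G where G: "G holomorphic_on UNIV" "\<And>z. F z = F 0 + z * G z"
    using entire_divided_difference[OF assms(1)] by blast
  have "F 0 = 0" using assms(2)[of 0] by simp
  then have F: "F z = z * G z" for z using G(2)[of z] by simp
  have "G (- z) = G z" for z
    using assms(2)[of z] F[of z] F[of "-z"] by (cases "z = 0") auto
  with that G(1) F show ?thesis by blast
qed

lemma entire_even_factor:
  fixes F :: "complex \<Rightarrow> complex"
  assumes "F holomorphic_on UNIV" and "\<And>z. F (- z) = F z"
  obtains G where "G holomorphic_on UNIV" "\<And>z. F z = F 0 + z\<^sup>2 * G z"
proof -
  obtain G where G: "G holomorphic_on UNIV" "\<And>z. F z = F 0 + z * G z"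
    using entire_divided_difference[OF assms(1)] by blast
  have odd: "G (- z) = - G z" if "z \<noteq> 0" for z
  proof -
    have "z * G z = - z * G (- z)"
      using assms(2)[of z] by (simp only: G(2)[of z] G(2)[of "-z"] add_left_cancel)
    then have "z * (G (- z) + G z) = 0" by (simp add: ring_distribs)
    then show ?thesis using that by (simp add: eq_neg_iff_add_eq_0)
  qed
  \<comment> \<open>Oddness of \<open>G\<close> is known only away from 0, where z can be cancelled.
    Its value at 0 comes from continuity: G(-z) + G(z) vanishes near 0 and tends to 2 G(0).\<close>
  have "G 0 = 0"
  proof -
    have "continuous_on UNIV G" using G(1) by (rule holomorphic_on_imp_continuous_on)
    then have c: "isCont G 0" by (simp add: continuous_on_eq_continuous_at)
    then have "isCont (\<lambda>z. G (- z) + G z) 0"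
      by (intro continuous_intros isCont_o2[of 0 uminus G]) auto
    then have "((\<lambda>z. G (- z) + G z) \<longlongrightarrow> G 0 + G 0) (at 0)"
      by (auto dest: isContD)
    moreover have "((\<lambda>z. G (- z) + G z) \<longlongrightarrow> 0) (at 0)"
      by (rule tendsto_eventually) (auto simp: eventually_at_filter odd)
    ultimately have "G 0 + G 0 = 0" by (intro tendsto_unique[of "at 0"]) auto
    then show ?thesis by simp
  qed
  obtain H where H: "H holomorphic_on UNIV" "\<And>z. G z = G 0 + z * H z"
    using entire_divided_difference[OF G(1)] by blast
  have "F z = F 0 + z\<^sup>2 * H z" for z
    using G(2)[of z] H(2)[of z] \<open>G 0 = 0\<close> by (simp add: power2_eq_square mult.assoc)
  with that H(1) show ?thesis by blast
qed

text \<open>The value of \<open>F\<close> at \<open>z\<close> itself is left free, because a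
  quotient takes the meaningless value 0 where its denominator vanishes; only a punctured
  neighbourhood counts.\<close>

definition removable_at :: "(complex \<Rightarrow> complex) \<Rightarrow> complex \<Rightarrow> bool" where
  "removable_at F z \<longleftrightarrow> (\<exists>G. G analytic_on {z} \<and> eventually (\<lambda>w. F w = G w) (at z))"

lemma analytic_imp_removable_at: "F analytic_on {z} \<Longrightarrow> removable_at F z"
  unfolding removable_at_def by (rule exI[of _ F]) simp

lemma removable_at_add:
  assumes "removable_at F z" "removable_at H z"
  shows "removable_at (\<lambda>w. F w + H w) z"
proof -
  obtain G K where "G analytic_on {z}" "eventually (\<lambda>w. F w = G w) (at z)"
    "K analytic_on {z}" "eventually (\<lambda>w. H w = K w) (at z)"
    using assms unfolding removable_at_def by blast
  then show ?thesis unfolding removable_at_def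
    by (intro exI[of _ "\<lambda>w. G w + K w"]) (auto intro: analytic_intros elim: eventually_elim2)
qed

lemma removable_at_shift:
  assumes "removable_at (\<lambda>u. F (u + a)) z"
  shows "removable_at F (z + a)"
proof -
  obtain G where G: "G analytic_on {z}" "eventually (\<lambda>u. F (u + a) = G u) (at z)"
    using assms unfolding removable_at_def by blast
  have "(\<lambda>w. G (w - a)) analytic_on {z + a}"
    by (rule analytic_on_compose_gen[of "\<lambda>w. w - a" _ G, unfolded o_def])
       (use G in \<open>auto intro!: analytic_intros\<close>)
  moreover have "eventually (\<lambda>w. F w = G (w - a)) (at (z + a))"
    using G(2) by (subst at_to_0, subst (asm) at_to_0) (simp add: eventually_filtermap add_ac)
  ultimately show ?thesis unfolding removable_at_def by blast
qed

section \<open>Period lattice and doubly periodic functions\<close>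

definition period_lattice :: "complex \<Rightarrow> complex set" where
  "period_lattice \<tau> = {of_int m * of_real pi + of_int n * (of_real pi * \<tau>) | m n. True}"

lemma periodic_int:
  fixes F :: "complex \<Rightarrow> 'a" and c :: complex
  assumes "\<And>z. F (z + c) = F z"
  shows "F (z + of_int m * c) = F z"
proof -
  have nat: "F (z + of_nat k * c) = F z" for k z
  proof (induction k arbitrary: z)
    case (Suc k)
    show ?case using Suc[of "z + c"] assms[of z] by (simp add: algebra_simps)
  qed simp
  show ?thesis
  proof (cases "m \<ge> 0")
    case True
    then show ?thesis using nat[of z "nat m"] by simp
  next
    case False
    \<comment> \<open>For negative \<open>m\<close> the walk starts at z + m c and goes forward to
      z.\<close>
    then show ?thesis using nat[of "z + of_int m * c" "nat (-m)"] by simp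
  qed
qed

text \<open>The target type is arbitrary so that the lemma also covers truth values:
  \<open>theta1\<close> is only quasi-periodic, but whether it vanishes is periodic.\<close>

lemma periodic_lattice:
  fixes F :: "complex \<Rightarrow> 'a"
  assumes "\<And>z. F (z + of_real pi) = F z" "\<And>z. F (z + of_real pi * \<tau>) = F z"
    and "l \<in> period_lattice \<tau>"
  shows "F (z + l) = F z"
proof -
  obtain m n where "l = of_int m * of_real pi + of_int n * (of_real pi * \<tau>)"
    using assms(3) by (auto simp: period_lattice_def)
  then show ?thesis
    using periodic_int[of F "of_real pi * \<tau>", OF assms(2), of "z + of_int m * of_real pi" n]
      periodic_int[of F "of_real pi", OF assms(1), of z m] by (simp add: add.assoc)
qed

lemma fundamental_parallelogram:
  assumes "Im \<tau> > 0"
  obtains s t l where "0 \<le> s" "s \<le> 1" "0 \<le> t" "t \<le> 1" "l \<in> period_lattice \<tau>"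
    "z = of_real s * of_real pi + of_real t * (of_real pi * \<tau>) + l"
proof -
  define t where "t = Im z / (pi * Im \<tau>)"
  define s where "s = (Re z - t * pi * Re \<tau>) / pi"
  have z: "z = of_real s * of_real pi + of_real t * (of_real pi * \<tau>)"
    using assms by (simp add: complex_eq_iff s_def t_def)
  show ?thesis
  proof (rule that[of "frac s" "frac t" "of_int \<lfloor>s\<rfloor> * of_real pi + of_int \<lfloor>t\<rfloor> * (of_real pi * \<tau>)"])
    show "z = of_real (frac s) * of_real pi + of_real (frac t) * (of_real pi * \<tau>) +
       (of_int \<lfloor>s\<rfloor> * of_real pi + of_int \<lfloor>t\<rfloor> * (of_real pi * \<tau>))"
      by (subst z) (simp add: frac_def algebra_simps)
  qed (auto simp: period_lattice_def frac_ge_0 less_imp_le[OF frac_lt_1])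
qed

text \<open>Passing to limits turns \<open>F\<close> into an entire function with the same periods.
  All its values occur on a compact fundamental parallelogram, so it is bounded and Liouville's
  theorem applies. At a removable point the value of \<open>F\<close> may be wrong; there only the
  second conclusion gives information.\<close>

lemma elliptic_removable_imp_constant:
  assumes tau: "Im \<tau> > 0"
    and per: "\<And>z. F (z + of_real pi) = F z" "\<And>z. F (z + of_real pi * \<tau>) = F z"
    and rem: "\<And>z. removable_at F z"
  obtains c where "\<And>z. F analytic_on {z} \<Longrightarrow> F z = c" "\<And>z. eventually (\<lambda>w. F w = c) (at z)"
proof -
  define E where "E z = Lim (at z) F" for z
  have E_eq: "E z = H z" if "isCont H z" "eventually (\<lambda>w. F w = H w) (at z)" for H z
  proof -
    have "(H \<longlongrightarrow> H z) (at z)" using that(1) by (rule isContD)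
    then have "(F \<longlongrightarrow> H z) (at z)" using that(2) by (simp add: tendsto_cong)
    then show ?thesis unfolding E_def by (intro tendsto_Lim) auto
  qed
  \<comment> \<open>An analytic function that agrees with \<open>F\<close> off z also agrees with
    \<open>F\<close> around each neighbouring point, so it equals the limit function
    \<open>E\<close> on a full neighbourhood of z.\<close>
  have loc: "\<exists>H S. open S \<and> z \<in> S \<and> H holomorphic_on S \<and> (\<forall>w\<in>S. E w = H w) \<and> (\<forall>w\<in>S-{z}. F w = H w)" for z
  proof -
    obtain G where G: "G analytic_on {z}" "eventually (\<lambda>w. F w = G w) (at z)"
      using rem[of z] unfolding removable_at_def by blast
    obtain S1 where S1: "open S1" "z \<in> S1" "G holomorphic_on S1"
      using G(1) by (auto simp: analytic_at)
    obtain S2 where S2: "open S2" "z \<in> S2" "\<And>w. w \<in> S2 \<Longrightarrow> w \<noteq> z \<Longrightarrow> F w = G w"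
      using G(2) unfolding eventually_at_topological by blast
    have "E w = G w" if w: "w \<in> S1 \<inter> S2" for w
    proof (rule E_eq)
      show "isCont G w"
        using holomorphic_on_imp_continuous_on[OF S1(3)] S1(1) w
        by (auto simp: continuous_on_eq_continuous_at)
      show "eventually (\<lambda>v. F v = G v) (at w)"
      proof (cases "w = z")
        case False
        then have "eventually (\<lambda>v. v \<in> S2 - {z}) (at w)"
          using w S2(1) by (intro eventually_at_in_open') (auto intro: open_delete)
        then show ?thesis by eventually_elim (use S2(3) in auto)
      qed (use G in auto)
    qed
    then show ?thesis
      using S1 S2 by (intro exI[of _ G] exI[of _ "S1 \<inter> S2"]) (auto intro: holomorphic_on_subset)
  qed
  have "E analytic_on {z}" for z
  proof -
    obtain H S where "open S" "z \<in> S" "H holomorphic_on S" "\<forall>w\<in>S. E w = H w"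
      using loc[of z] by blast
    then have "E holomorphic_on S" by (subst holomorphic_cong[of S S E H]) auto
    then show ?thesis using \<open>open S\<close> \<open>z \<in> S\<close> by (auto simp: analytic_at)
  qed
  then have hol: "E holomorphic_on UNIV"
    by (intro analytic_imp_holomorphic) (subst analytic_on_analytic_at, auto)
  \<comment> \<open>\<open>Lim\<close> is a definite description, so it is enough that
    \<open>F\<close> has the same limits at z and at z + a; no limit has to exist for this.\<close>
  have E_shift: "E (z + a) = E z" if "\<And>z. F (z + a) = F z" for a z
  proof -
    have fm: "filtermap (\<lambda>w. w - a) (at (z + a)) = at z"
      using filtermap_at_shift[of a "z + a"] by simp
    have F: "F (w - a) = F w" for w using that[of "w - a"] by simp
    have "(F \<longlongrightarrow> l) (at z) \<longleftrightarrow> ((\<lambda>w. F (w - a)) \<longlongrightarrow> l) (at (z + a))" for l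
      by (subst fm[symmetric]) (rule filterlim_filtermap)
    then show ?thesis by (simp add: E_def Topological_Spaces.Lim_def F)
  qed
  define K where "K = (\<lambda>(s::real, t::real). of_real s * of_real pi + of_real t * (of_real pi * \<tau>)) ` ({0..1} \<times> {0..1})"
  have "compact K" unfolding K_def
    by (intro compact_continuous_image compact_Times)
       (auto simp: case_prod_unfold intro!: continuous_intros)
  then have "bounded (E ` K)"
    using hol by (intro compact_imp_bounded compact_continuous_image)
       (auto intro: holomorphic_on_imp_continuous_on holomorphic_on_subset)
  moreover have "range E \<subseteq> E ` K"
  proof
    fix y assume "y \<in> range E"
    then obtain z where z: "y = E z" by blast
    obtain s t l where stl: "0 \<le> s" "s \<le> 1" "0 \<le> t" "t \<le> 1" "l \<in> period_lattice \<tau>"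
      "z = of_real s * of_real pi + of_real t * (of_real pi * \<tau>) + l"
      using fundamental_parallelogram[OF tau] by blast
    have "E z = E (of_real s * of_real pi + of_real t * (of_real pi * \<tau>))"
      unfolding stl(6) by (rule periodic_lattice[where \<tau> = \<tau>]) (use E_shift per stl in auto)
    then show "y \<in> E ` K" unfolding z K_def using stl by force
  qed
  ultimately have "bounded (range E)" by (rule bounded_subset)
  then obtain c where c: "\<And>z. E z = c"
    using Liouville_theorem[OF hol] by (auto simp: constant_on_def)
  show ?thesis
  proof (rule that)
    show "F z = c" if "F analytic_on {z}" for z
      using E_eq[where H = F and z = z] analytic_at_imp_isCont[OF that] c by simp
    show "eventually (\<lambda>w. F w = c) (at z)" for z
    proof -
      obtain H S where "open S" "z \<in> S" "\<forall>w\<in>S. E w = H w" "\<forall>w\<in>S-{z}. F w = H w"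
        using loc[of z] by blast
      then show ?thesis unfolding eventually_at_topological
        by (intro exI[of _ S]) (metis c DiffI singletonD)
    qed
  qed
qed

section \<open>Derivatives and the polar part at a half period\<close>

lemma entire_analytic: "F holomorphic_on UNIV \<Longrightarrow> F analytic_on A"
  by (meson analytic_on_open analytic_on_subset open_UNIV subset_UNIV)

lemma deriv_linear_factor:
  assumes "G holomorphic_on UNIV" "\<And>z. F z = z * G z"
  shows "deriv F z = G z + z * deriv G z"
proof -
  have "F = (\<lambda>z. z * G z)" using assms(2) by blast
  moreover have "((\<lambda>z. z * G z) has_field_derivative (G z + z * deriv G z)) (at z)"
    by (auto intro!: derivative_eq_intros entire_has_deriv[OF assms(1)])
  ultimately show ?thesis by (simp add: DERIV_imp_deriv)
qed

lemma deriv_square_factor: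
  assumes "G holomorphic_on UNIV" "\<And>z. F z = c + z\<^sup>2 * G z"
  shows "deriv F z = 2 * z * G z + z\<^sup>2 * deriv G z"
proof -
  have "F = (\<lambda>z. c + z\<^sup>2 * G z)" using assms(2) by blast
  moreover have "((\<lambda>z. c + z\<^sup>2 * G z) has_field_derivative (2 * z * G z + z\<^sup>2 * deriv G z)) (at z)"
    by (auto intro!: derivative_eq_intros entire_has_deriv[OF assms(1)])
  ultimately show ?thesis by (simp add: DERIV_imp_deriv)
qed

lemma deriv_shift: "deriv g (u + w) = deriv (\<lambda>v. g (v + w)) u"
  by (simp add: deriv_def DERIV_shift)

text \<open>
  Here \<open>\<theta>(u) = u \<phi>(u)\<close> with \<open>\<phi>(u) = a + u\<^sup>2 b(u)\<close>, and \<open>\<Phi>\<close>, \<open>B\<close>, \<open>B'\<close>, \<open>T\<close> stand for \<open>\<phi>\<close>, \<open>b\<close>, \<open>b'\<close>, \<open>\<theta>'\<close>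
  at \<open>2u\<close>. The denominator of the right-hand side does not vanish at \<open>u = 0\<close>: the terms in
  \<open>u\<^sup>-\<^sup>3\<close> cancel by the choice of the factor \<open>a / 4\<close>, those in \<open>u\<^sup>-\<^sup>1\<close> because \<open>B - b\<close> is
  divisible by \<open>u\<close>.
\<close>

lemma laurent_cancellation_identity:
  fixes u a h0 H H' B b B' D h h' \<Phi> \<phi> T :: complex
  assumes nz: "u \<noteq> 0" "\<Phi> \<noteq> 0" "\<phi> \<noteq> 0"
    and h: "h = h0 + u\<^sup>2 * H" and h': "h' = 2 * u * H + u\<^sup>2 * H'"
    and \<phi>: "\<phi> = a + u\<^sup>2 * b" and \<Phi>: "\<Phi> = a + (2 * u)\<^sup>2 * B"
    and T: "T = \<Phi> + (2 * u) * (2 * (2 * u) * B + (2 * u)\<^sup>2 * B')"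
    and D: "B = b + u * D"
  shows "(h' * (2 * u * \<Phi>)\<^sup>2 - h * (4 * (2 * u * \<Phi>) * T)) / (2 * u * \<Phi>) ^ 4
      + a / 4 * h0 * (2 * u * \<Phi> / (u * \<phi>) ^ 4) =
     (4 * h0 * (4 * a ^ 4 * D + u * (16 * a * B\<^sup>2 * (6 * a\<^sup>2 + 16 * a * u\<^sup>2 * B + 16 * u ^ 4 * B\<^sup>2)
        - 48 * a ^ 3 * B * b - (a + 12 * u\<^sup>2 * B) * b\<^sup>2 * (6 * a\<^sup>2 + 4 * a * u\<^sup>2 * b + u ^ 4 * b\<^sup>2)))
      + (2 * H' * \<Phi> - 32 * u * H * B - 32 * h * B') * \<phi> ^ 4) / (8 * \<Phi> ^ 3 * \<phi> ^ 4)"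
    (is "_ = ?X / _")
proof -
  \<comment> \<open>\<open>a + 12 * u\<^sup>2 * B\<close> is \<open>T\<close> without its term in
    u^3; everything else collects into a multiple of u^3.\<close>
  have 1: "2 * u * h' * \<Phi> - 4 * h * T = - 4 * h0 * (a + 12 * u\<^sup>2 * B) + u ^ 3 * (2 * H' * \<Phi> - 32 * u * H * B - 32 * h * B')"
    unfolding T h' unfolding h \<Phi> by algebra
  \<comment> \<open>The constant terms cancel, and the terms in u^2 have the coefficient 16 a^4 B -
    12 a^4 B - 4 a^4 b = 4 a^4 (B - b), which \<open>D\<close> turns into 4 a^4 u D. This yields the
    factor u^3.\<close>
  have 2: "a * \<Phi> ^ 4 - (a + 12 * u\<^sup>2 * B) * \<phi> ^ 4 = u ^ 3 * (4 * a ^ 4 * D + u * (16 * a * B\<^sup>2 * (6 * a\<^sup>2 + 16 * a * u\<^sup>2 * B + 16 * u ^ 4 * B\<^sup>2)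
        - 48 * a ^ 3 * B * b - (a + 12 * u\<^sup>2 * B) * b\<^sup>2 * (6 * a\<^sup>2 + 4 * a * u\<^sup>2 * b + u ^ 4 * b\<^sup>2)))"
    using D unfolding \<Phi> \<phi> by algebra
  have 3: "(2 * u * h' * \<Phi> - 4 * h * T) * \<phi> ^ 4 + 4 * a * h0 * \<Phi> ^ 4 = u ^ 3 * ?X"
    unfolding 1 using 2 by algebra
  have "(h' * (2 * u * \<Phi>)\<^sup>2 - h * (4 * (2 * u * \<Phi>) * T)) / (2 * u * \<Phi>) ^ 4
      + a / 4 * h0 * (2 * u * \<Phi> / (u * \<phi>) ^ 4) =
      ((2 * u * h' * \<Phi> - 4 * h * T) * \<phi> ^ 4 + 4 * a * h0 * \<Phi> ^ 4) / (u ^ 3 * (8 * \<Phi> ^ 3 * \<phi> ^ 4))"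
    using nz by (simp add: field_simps power2_eq_square power3_eq_cube power4_eq_xxxx)
  then show ?thesis unfolding 3 using nz by simp
qed

lemma deriv_quotient_double_square:
  assumes "\<theta> holomorphic_on UNIV" "h holomorphic_on UNIV" "\<theta> (2 * u) \<noteq> 0"
  shows "deriv (\<lambda>v. h v / (\<theta> (2 * v))\<^sup>2) u =
    (deriv h u * (\<theta> (2 * u))\<^sup>2 - h u * (4 * \<theta> (2 * u) * deriv \<theta> (2 * u))) / \<theta> (2 * u) ^ 4"
proof (rule DERIV_imp_deriv)
  show "((\<lambda>v. h v / (\<theta> (2 * v))\<^sup>2) has_field_derivative
    (deriv h u * (\<theta> (2 * u))\<^sup>2 - h u * (4 * \<theta> (2 * u) * deriv \<theta> (2 * u))) / \<theta> (2 * u) ^ 4) (at u)"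
    using assms(3)
    by (auto intro!: derivative_eq_intros entire_has_deriv[OF assms(2)]
         DERIV_chain2[of \<theta> _ "\<lambda>v. 2 * v"] entire_has_deriv[OF assms(1)]
         simp: power2_eq_square power4_eq_xxxx mult.assoc)
qed

text \<open>Put a = \<open>deriv \<theta> 0\<close>. The quotient is even with at most a double
  pole, so its derivative has the polar part -h(0) / (2 a^2 u^3). Since \<theta>(2u) / \<theta>(u)^4
  has the polar part 2 / (a^3 u^3), the weight a h(0) / 4 cancels it.\<close>

lemma removable_deriv_quotient:
  fixes \<theta> h :: "complex \<Rightarrow> complex"
  assumes \<theta>: "\<theta> holomorphic_on UNIV" "\<And>z. \<theta> (- z) = - \<theta> z" "deriv \<theta> 0 \<noteq> 0"
    and h: "h holomorphic_on UNIV" "\<And>z. h (- z) = h z"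
  shows "removable_at (\<lambda>u. deriv (\<lambda>v. h v / (\<theta> (2 * v))\<^sup>2) u + deriv \<theta> 0 / 4 * h 0 * (\<theta> (2 * u) / \<theta> u ^ 4)) 0"
proof -
  obtain \<phi> where \<phi>: "\<phi> holomorphic_on UNIV" "\<And>z. \<theta> z = z * \<phi> z" "\<And>z. \<phi> (- z) = \<phi> z"
    using entire_odd_factor[OF \<theta>(1,2)] by blast
  obtain b where b: "b holomorphic_on UNIV" "\<And>z. \<phi> z = \<phi> 0 + z\<^sup>2 * b z"
    using entire_even_factor[OF \<phi>(1,3)] by blast
  obtain H where H: "H holomorphic_on UNIV" "\<And>z. h z = h 0 + z\<^sup>2 * H z"
    using entire_even_factor[OF h] by blast
  obtain d where d: "d holomorphic_on UNIV" "\<And>z. b z = b 0 + z * d z"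
    using entire_divided_difference[OF b(1)] by blast
  have a: "deriv \<theta> 0 = \<phi> 0" "\<phi> 0 \<noteq> 0"
    using deriv_linear_factor[OF \<phi>(1,2), of 0] \<theta>(3) by auto
  \<comment> \<open>From b(2u) - b(u) = u (2 d(2u) - d(u)): the \<open>D\<close> of the cancellation
    identity as an entire function.\<close>
  define D where "D u = 2 * d (2 * u) - d u" for u
  have B: "b (2 * u) = b u + u * D u" for u
    using d(2)[of u] d(2)[of "2 * u"] by (simp add: D_def algebra_simps)
  \<comment> \<open>The numerator in the cancellation identity. The denominator equals 8 a^7 at 0
    with a = \<open>\<phi> 0\<close>, which is not zero, so the quotient \<open>G\<close> is
    analytic there.\<close>
  define X where "X u = 4 * h 0 * (4 * \<phi> 0 ^ 4 * D u + u * (16 * \<phi> 0 * (b (2 * u))\<^sup>2 *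
         (6 * (\<phi> 0)\<^sup>2 + 16 * \<phi> 0 * u\<^sup>2 * b (2 * u) + 16 * u ^ 4 * (b (2 * u))\<^sup>2)
        - 48 * \<phi> 0 ^ 3 * b (2 * u) * b u - (\<phi> 0 + 12 * u\<^sup>2 * b (2 * u)) * (b u)\<^sup>2 *
          (6 * (\<phi> 0)\<^sup>2 + 4 * \<phi> 0 * u\<^sup>2 * b u + u ^ 4 * (b u)\<^sup>2)))
      + (2 * deriv H u * \<phi> (2 * u) - 32 * u * H u * b (2 * u) - 32 * h u * deriv b (2 * u)) * \<phi> u ^ 4" for u
  define G where "G u = X u / (8 * \<phi> (2 * u) ^ 3 * \<phi> u ^ 4)" for u
  have dH: "deriv H holomorphic_on UNIV" "deriv b holomorphic_on UNIV"
    using H b by (auto intro: holomorphic_deriv)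
  have comp: "(\<lambda>u. F (2 * u)) holomorphic_on UNIV" if "F holomorphic_on UNIV" for F :: "complex \<Rightarrow> complex"
    by (rule entire_compose[OF that]) (intro holomorphic_intros)
  note hol = \<phi>(1) dH(1) H(1) h(1) b(1) d(1) comp[OF b(1)] comp[OF d(1)] comp[OF \<phi>(1)] comp[OF dH(2)]
  have X_hol: "X holomorphic_on UNIV"
    unfolding X_def[abs_def] D_def
    by (intro hol holomorphic_on_add holomorphic_on_diff holomorphic_on_mult holomorphic_on_power
         holomorphic_on_const holomorphic_on_ident)
  have "(\<lambda>u. 8 * \<phi> (2 * u) ^ 3 * \<phi> u ^ 4) holomorphic_on UNIV"
    by (intro hol holomorphic_on_mult holomorphic_on_power holomorphic_on_const)
  then have G_an: "G analytic_on {0}"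
    unfolding G_def[abs_def] using a(2) by (intro analytic_on_divide entire_analytic X_hol) auto
  have "isCont \<phi> 0"
    using holomorphic_on_imp_continuous_on[OF \<phi>(1)] by (simp add: continuous_on_eq_continuous_at)
  then have "eventually (\<lambda>u. \<phi> u \<noteq> 0) (at 0)" "eventually (\<lambda>u. \<phi> (2 * u) \<noteq> 0) (at 0)"
  proof -
    have c: "(\<phi> \<longlongrightarrow> \<phi> 0) (at 0)" using \<open>isCont \<phi> 0\<close> by (rule isContD)
    then show "eventually (\<lambda>u. \<phi> u \<noteq> 0) (at 0)" using a(2) by (rule tendsto_imp_eventually_ne)
    have "isCont (\<lambda>u. \<phi> (2 * u)) 0"
      by (rule isCont_o2[where g = \<phi>]) (use \<open>isCont \<phi> 0\<close> in \<open>auto intro!: continuous_intros\<close>)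
    then have "((\<lambda>u. \<phi> (2 * u)) \<longlongrightarrow> \<phi> (2 * 0)) (at 0)" by (rule isContD)
    then show "eventually (\<lambda>u. \<phi> (2 * u) \<noteq> 0) (at 0)" by (rule tendsto_imp_eventually_ne) (use a in simp)
  qed
  moreover have "eventually (\<lambda>u::complex. u \<noteq> 0) (at 0)" by (rule eventually_neq_at_within)
  ultimately have "eventually (\<lambda>u. deriv (\<lambda>v. h v / (\<theta> (2 * v))\<^sup>2) u
      + deriv \<theta> 0 / 4 * h 0 * (\<theta> (2 * u) / \<theta> u ^ 4) = G u) (at 0)"
  proof eventually_elim
    case (elim u)
    have "\<theta> (2 * u) \<noteq> 0" using elim \<phi>(2)[of "2 * u"] by simp
    note deriv_quotient_double_square[OF \<theta>(1) h(1) this]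
    then show ?case
      unfolding G_def X_def a(1) \<phi>(2)[of u] \<phi>(2)[of "2 * u"]
      using laurent_cancellation_identity[OF elim(3,2,1) H(2)[of u] deriv_square_factor[OF H, of u]
         b(2)[of u] b(2)[of "2 * u"] _ B[of u], of "deriv \<theta> (2 * u)" "deriv b (2 * u)"]
        deriv_linear_factor[OF \<phi>(1,2), of "2 * u"] deriv_square_factor[OF b, of "2 * u"]
      by simp
  qed
  then show ?thesis unfolding removable_at_def using G_an by blast
qed

section \<open>Theta functions\<close>

primrec euler_coeff :: "complex \<Rightarrow> nat \<Rightarrow> complex" where
  "euler_coeff q 0 = 1"
| "euler_coeff q (Suc n) = - (q ^ n / (1 - q ^ Suc n)) * euler_coeff q n"

text \<open>
  The power series of Euler's product \<open>\<Prod>k. 1 - q\<^sup>k w\<close>: its functional equation and its zeros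
  can be read off without any infinite products.
\<close>

definition euler_fun :: "complex \<Rightarrow> complex \<Rightarrow> complex" where
  "euler_fun q w = (\<Sum>n. euler_coeff q n * w ^ n)"

context
  fixes q :: complex
  assumes q: "norm q < 1"
begin

lemma summable_euler: "summable (\<lambda>n. euler_coeff q n * w ^ n)"
proof (rule summable_powser_entire)
  show "euler_coeff q (Suc n) = - (q ^ n / (1 - q ^ Suc n)) * euler_coeff q n" for n by simp
  have p: "(\<lambda>n. q ^ n) \<longlonglongrightarrow> 0" using q by (rule LIMSEQ_power_zero)
  have "(\<lambda>n. - (q ^ n / (1 - q ^ Suc n))) \<longlonglongrightarrow> - (0 / (1 - 0))"
    by (intro tendsto_intros p LIMSEQ_Suc[OF p]) auto
  then show "(\<lambda>n. - (q ^ n / (1 - q ^ Suc n))) \<longlonglongrightarrow> 0" by simp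
qed

lemma holomorphic_euler_fun: "euler_fun q holomorphic_on UNIV"
  unfolding euler_fun_def[abs_def] by (rule holomorphic_powser_entire[OF summable_euler])

text \<open>Comparing coefficients of w^(n+1) gives (1 - q^(n+1)) c_(n+1) = - q^n c_n, which is the
  recursion of \<open>euler_coeff\<close>.\<close>

lemma euler_fun_shift: "euler_fun q w = (1 - w) * euler_fun q (q * w)"
proof -
  let ?f = "\<lambda>w n. euler_coeff q n * w ^ n"
  have ne: "1 - q ^ Suc n \<noteq> 0" for n
  proof -
    have "norm q ^ Suc n \<le> norm q" using q by (intro power_Suc_le_self) auto
    then have "norm (q ^ Suc n) < 1" unfolding norm_power using q by (rule order.strict_trans1)
    then show ?thesis by auto
  qed
  have S: "?f w sums euler_fun q w" for w
    unfolding euler_fun_def by (rule summable_sums[OF summable_euler])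
  have "(\<lambda>n. ?f w n - ?f (q * w) n) sums (euler_fun q w - euler_fun q (q * w))"
    by (intro sums_diff S)
  then have 1: "(\<lambda>n. ?f w (Suc n) - ?f (q * w) (Suc n)) sums (euler_fun q w - euler_fun q (q * w))"
    by (subst sums_Suc_iff[of "\<lambda>n. ?f w n - ?f (q * w) n"]) simp
  have 2: "?f w (Suc n) - ?f (q * w) (Suc n) = - w * ?f (q * w) n" for n
  proof -
    have "?f w (Suc n) - ?f (q * w) (Suc n) =
        ((1 - q ^ Suc n) * euler_coeff q (Suc n)) * w ^ Suc n"
      by (simp only: power_mult_distrib) (simp add: algebra_simps del: euler_coeff.simps power_Suc)
    also have "(1 - q ^ Suc n) * euler_coeff q (Suc n) = - (q ^ n * euler_coeff q n)"
      using ne[of n] by simp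
    finally show ?thesis by (simp add: power_mult_distrib mult_ac)
  qed
  have "(\<lambda>n. - w * ?f (q * w) n) sums (- w * euler_fun q (q * w))"
    by (intro sums_mult S)
  with 1 have "euler_fun q w - euler_fun q (q * w) = - w * euler_fun q (q * w)"
    unfolding 2 by (rule sums_unique2)
  then show ?thesis by (simp add: algebra_simps)
qed

lemma euler_fun_0: "euler_fun q 0 = 1"
  unfolding euler_fun_def by (subst powser_zero) simp

text \<open>If no factor 1 - q^k w vanished, the functional equation would carry the zero from w to
  every q^n w. These points tend to 0, where the function is 1.\<close>

lemma euler_fun_eq_0D:
  assumes "euler_fun q w = 0"
  obtains k where "q ^ k * w = 1"
proof (rule ccontr)
  assume "\<not> thesis"
  then have ne: "q ^ k * w \<noteq> 1" for k using that by blast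
  have zero: "euler_fun q (q ^ n * w) = 0" for n
  proof (induction n)
    case (Suc n)
    then show ?case using euler_fun_shift[of "q ^ n * w"] ne[of n] by (simp add: mult.assoc)
  qed (use assms in simp)
  have "(\<lambda>n. q ^ n * w) \<longlonglongrightarrow> 0"
    using q by (intro tendsto_mult_left_zero LIMSEQ_power_zero)
  moreover have "isCont (euler_fun q) 0"
    using holomorphic_on_imp_continuous_on[OF holomorphic_euler_fun]
    by (simp add: continuous_on_eq_continuous_at)
  ultimately have "(\<lambda>n. euler_fun q (q ^ n * w)) \<longlonglongrightarrow> euler_fun q 0"
    by (rule isCont_tendsto_compose[rotated])
  then show False by (simp add: zero euler_fun_0 LIMSEQ_const_iff)
qed

end

section \<open>Theta series and their quasi-periods\<close>

lemma qpow_add: "qpow \<tau> (a + b) = qpow \<tau> a * qpow \<tau> b"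
  by (simp add: qpow_def exp_add[symmetric] algebra_simps)

lemma qpow_nonzero [simp]: "qpow \<tau> a \<noteq> 0"
  by (simp add: qpow_def)

lemma qpow_power: "qpow \<tau> a ^ n = qpow \<tau> (of_nat n * a)"
  by (simp add: qpow_def exp_of_nat_mult[symmetric] mult_ac)

lemma qpow_0 [simp]: "qpow \<tau> 0 = 1"
  by (simp add: qpow_def)

text \<open>One half of Jacobi's series over all integers. Being a power series, it is easily seen
  to be entire; the two halves are joined in \<open>theta1_partial_theta\<close> and
  \<open>theta4_partial_theta\<close>.\<close>

definition partial_theta :: "complex \<Rightarrow> complex \<Rightarrow> complex" where
  "partial_theta \<tau> w = (\<Sum>n. qpow \<tau> ((of_nat n)\<^sup>2 / 2) * w ^ n)"

text \<open>Jacobi's triple product for \<open>theta1\<close> up to a constant factor. The extra q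
  in the last argument keeps the zeros with e^(2iz) = 1 from being counted twice.\<close>

definition theta_prod :: "complex \<Rightarrow> complex \<Rightarrow> complex" where
  "theta_prod \<tau> z = exp (- \<i> * z) * euler_fun (qpow \<tau> 1) (exp (2 * \<i> * z))
     * euler_fun (qpow \<tau> 1) (qpow \<tau> 1 * exp (- 2 * \<i> * z))"

lemma sin_add_nat_pi: "sin (w + of_nat n * of_real pi) = (-1) ^ n * sin (w :: complex)"
proof (induction n)
  case (Suc n)
  have "sin (w + of_nat (Suc n) * of_real pi) = sin ((w + of_nat n * of_real pi) + of_real pi)"
    by (simp add: algebra_simps)
  also have "\<dots> = - sin (w + of_nat n * of_real pi)"
    by (subst sin_add) (simp add: sin_of_real cos_of_real)
  finally show ?case using Suc by simp
qed simp

lemma cos_add_nat_pi: "cos (w + of_nat n * of_real pi) = (-1) ^ n * cos (w :: complex)"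
  using sin_add_nat_pi[of "w + of_real pi / 2" n] sin_add[of w "of_real pi / 2"]
    sin_add[of "w + of_nat n * of_real pi" "of_real pi / 2"]
  by (simp add: add_ac)

text \<open>The shift adds n pi + pi/2 to (2n+1) z, and the sign due to n pi cancels the alternating
  sign of the series.\<close>

lemma theta2_eq_theta1: "theta2 z \<tau> = theta1 (z + of_real pi / 2) \<tau>"
proof -
  have "sin ((2 * of_nat n + 1) * (z + of_real pi / 2)) = (-1) ^ n * cos ((2 * of_nat n + 1) * z)" for n :: nat
  proof -
    have "(2 * of_nat n + 1) * (z + complex_of_real pi / 2) =
        ((2 * of_nat n + 1) * z + of_real pi / 2) + of_nat n * of_real pi"
      by (simp add: algebra_simps)
    also have "sin \<dots> = (-1) ^ n * cos ((2 * of_nat n + 1) * z)"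
      unfolding sin_add_nat_pi by (simp add: sin_add)
    finally show ?thesis .
  qed
  then show ?thesis unfolding theta1_def theta2_def by (simp add: mult_ac)
qed

lemma theta3_eq_theta4: "theta3 z \<tau> = theta4 (z + of_real pi / 2) \<tau>"
proof -
  have "cos (2 * of_nat n * (z + of_real pi / 2)) = (-1) ^ n * cos (2 * of_nat n * z)" for n :: nat
    using cos_add_nat_pi[of "2 * of_nat n * z" n] by (simp add: algebra_simps)
  then show ?thesis unfolding theta3_def theta4_def by (simp add: mult_ac del: of_nat_Suc power_Suc)
qed

context
  fixes \<tau> :: complex
  assumes tau: "Im \<tau> > 0"
begin

lemma norm_qpow_1: "norm (qpow \<tau> 1) < 1"
  using tau by (simp add: qpow_def)

lemma summable_partial_theta: "summable (\<lambda>n. qpow \<tau> ((of_nat n)\<^sup>2 / 2) * w ^ n)"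
proof (rule summable_powser_entire)
  show "qpow \<tau> ((of_nat (Suc n))\<^sup>2 / 2) = (qpow \<tau> 1 ^ n * qpow \<tau> (1/2)) * qpow \<tau> ((of_nat n)\<^sup>2 / 2)" for n
    by (simp add: qpow_power qpow_add[symmetric] power2_eq_square field_simps)
  show "(\<lambda>n. qpow \<tau> 1 ^ n * qpow \<tau> (1/2)) \<longlonglongrightarrow> 0"
    by (intro tendsto_mult_left_zero LIMSEQ_power_zero norm_qpow_1)
qed

lemma partial_theta_sums: "(\<lambda>n. qpow \<tau> ((of_nat n)\<^sup>2 / 2) * w ^ n) sums partial_theta \<tau> w"
  unfolding partial_theta_def by (rule summable_sums[OF summable_partial_theta])

lemma holomorphic_partial_theta: "partial_theta \<tau> holomorphic_on UNIV"
  unfolding partial_theta_def[abs_def] by (rule holomorphic_powser_entire[OF summable_partial_theta])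

text \<open>The term n = 0 is split off, and (n+1)^2 / 2 = n^2 / 2 + n + 1/2 in the others.\<close>

lemma partial_theta_shift:
  "partial_theta \<tau> w = 1 + qpow \<tau> (1/2) * w * partial_theta \<tau> (qpow \<tau> 1 * w)"
proof -
  let ?f = "\<lambda>w n. qpow \<tau> ((of_nat n)\<^sup>2 / 2) * w ^ n"
  have "?f w (Suc n) = qpow \<tau> (1/2) * w * ?f (qpow \<tau> 1 * w) n" for n
  proof -
    have "qpow \<tau> ((of_nat (Suc n))\<^sup>2 / 2) = qpow \<tau> (1/2) * qpow \<tau> ((of_nat n)\<^sup>2 / 2) * qpow \<tau> 1 ^ n"
      by (simp add: qpow_power qpow_add[symmetric] power2_eq_square field_simps)
    then show ?thesis by (simp add: power_mult_distrib)
  qed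
  then have "(\<lambda>n. ?f w (Suc n)) sums (qpow \<tau> (1/2) * w * partial_theta \<tau> (qpow \<tau> 1 * w))"
    by (simp only:) (intro sums_mult partial_theta_sums)
  then have "?f w sums (qpow \<tau> (1/2) * w * partial_theta \<tau> (qpow \<tau> 1 * w) + 1)"
    by (subst (asm) sums_Suc_iff) simp
  then show ?thesis using sums_unique2[OF partial_theta_sums] by (simp add: add.commute)
qed

text \<open>The sine is written by exponentials, and (2n+1)^2 / 8 = n^2 / 2 + n/2 + 1/8, where n/2
  goes into the argument of the power series.\<close>

lemma theta1_partial_theta:
  "theta1 z \<tau> = - \<i> * qpow \<tau> (1/8) *
     (exp (\<i> * z) * partial_theta \<tau> (- qpow \<tau> (1/2) * exp (2 * \<i> * z))
      - exp (- \<i> * z) * partial_theta \<tau> (- qpow \<tau> (1/2) * exp (- 2 * \<i> * z)))" (is "_ = ?c * (?a * _ - ?b * _)")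
proof -
  let ?f = "\<lambda>w n. qpow \<tau> ((of_nat n)\<^sup>2 / 2) * w ^ n"
  have term_eq: "2 * ((-1) ^ n * qpow \<tau> ((2 * of_nat n + 1)\<^sup>2 / 8) * sin ((2 * of_nat n + 1) * z)) =
      ?c * (?a * ?f (- qpow \<tau> (1/2) * exp (2 * \<i> * z)) n
          - ?b * ?f (- qpow \<tau> (1/2) * exp (- 2 * \<i> * z)) n)" for n
  proof -
    have 1: "qpow \<tau> ((2 * of_nat n + 1)\<^sup>2 / 8) =
        qpow \<tau> (1/8) * qpow \<tau> ((of_nat n)\<^sup>2 / 2) * qpow \<tau> (1/2) ^ n"
      by (simp add: qpow_power qpow_add[symmetric] power2_eq_square field_simps)
    have 2: "exp (\<i> * ((2 * of_nat n + 1) * z)) = exp (\<i> * z) * exp (2 * \<i> * z) ^ n"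
      by (simp add: exp_of_nat_mult[symmetric] exp_add[symmetric] algebra_simps)
    have 3: "exp (- (\<i> * ((2 * of_nat n + 1) * z))) = exp (- \<i> * z) * exp (- 2 * \<i> * z) ^ n"
      by (simp add: exp_of_nat_mult[symmetric] exp_add[symmetric] algebra_simps)
    have 4: "2 * sin w = - \<i> * (exp (\<i> * w) - exp (- (\<i> * w)))" for w :: complex
      by (simp add: sin_exp_eq field_simps)
    have 5: "(- qpow \<tau> (1/2) * X) ^ n = (-1) ^ n * qpow \<tau> (1/2) ^ n * X ^ n" for X
      by (simp add: power_mult_distrib power_minus[of "_ * _"])
    have "2 * ((-1) ^ n * qpow \<tau> ((2 * of_nat n + 1)\<^sup>2 / 8) * sin ((2 * of_nat n + 1) * z)) =
       (-1) ^ n * qpow \<tau> ((2 * of_nat n + 1)\<^sup>2 / 8) * (2 * sin ((2 * of_nat n + 1) * z))" by simp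
    then show ?thesis unfolding 4 unfolding 1 2 3 5 by (simp add: algebra_simps)
  qed
  have "(\<lambda>n. ?c * (?a * ?f (- qpow \<tau> (1/2) * exp (2 * \<i> * z)) n
          - ?b * ?f (- qpow \<tau> (1/2) * exp (- 2 * \<i> * z)) n)) sums
       (?c * (?a * partial_theta \<tau> (- qpow \<tau> (1/2) * exp (2 * \<i> * z))
      - ?b * partial_theta \<tau> (- qpow \<tau> (1/2) * exp (- 2 * \<i> * z))))"
    by (intro sums_mult sums_diff partial_theta_sums)
  from sums_divide[OF this[folded term_eq], of 2] show ?thesis
    unfolding theta1_def by (simp add: sums_iff)
qed

text \<open>The term n = 0 occurs in both halves, hence the -1.\<close>

lemma theta4_partial_theta:
  "theta4 z \<tau> = partial_theta \<tau> (- exp (2 * \<i> * z)) + partial_theta \<tau> (- exp (- 2 * \<i> * z)) - 1"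
proof -
  let ?f = "\<lambda>w n. qpow \<tau> ((of_nat n)\<^sup>2 / 2) * w ^ n"
  have sh: "(\<lambda>n. ?f w (Suc n)) sums (partial_theta \<tau> w - 1)" for w
    using partial_theta_sums[of w] by (subst sums_Suc_iff) simp
  have term_eq: "(-1) ^ n * qpow \<tau> ((of_nat n)\<^sup>2 / 2) * cos (2 * of_nat n * z) =
      (?f (- exp (2 * \<i> * z)) n + ?f (- exp (- 2 * \<i> * z)) n) / 2" for n
  proof -
    have 2: "exp (\<i> * (2 * of_nat n * z)) = exp (2 * \<i> * z) ^ n"
      by (simp add: exp_of_nat_mult[symmetric] algebra_simps)
    have 3: "exp (- (\<i> * (2 * of_nat n * z))) = exp (- 2 * \<i> * z) ^ n"
      by (simp add: exp_of_nat_mult[symmetric] algebra_simps)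
    have 4: "2 * cos w = exp (\<i> * w) + exp (- (\<i> * w))" for w :: complex
      by (simp add: cos_exp_eq)
    have 5: "(- X) ^ n = (-1) ^ n * X ^ n" for X :: complex
      by (rule power_minus)
    have "2 * ((-1) ^ n * qpow \<tau> ((of_nat n)\<^sup>2 / 2) * cos (2 * of_nat n * z)) =
       (-1) ^ n * qpow \<tau> ((of_nat n)\<^sup>2 / 2) * (2 * cos (2 * of_nat n * z))" by simp
    then show ?thesis unfolding 4 unfolding 2 3 5[of "exp _"] by (simp add: algebra_simps)
  qed
  from sums_divide[OF sums_add[OF sh[of "- exp (2 * \<i> * z)"] sh[of "- exp (- 2 * \<i> * z)"]], of 2, folded term_eq]
  show ?thesis unfolding theta4_def by (simp add: sums_unique[symmetric] add_divide_distrib diff_divide_distrib del: of_nat_Suc power_Suc)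
qed

lemma theta1_minus: "theta1 (- z) \<tau> = - theta1 z \<tau>"
  unfolding theta1_partial_theta by (simp add: algebra_simps)

lemma theta1_add_pi: "theta1 (z + of_real pi) \<tau> = - theta1 z \<tau>"
proof -
  have "exp (\<i> * (z + of_real pi)) = - exp (\<i> * z)"
    "exp (- \<i> * (z + of_real pi)) = - exp (- \<i> * z)"
    "exp (2 * \<i> * (z + of_real pi)) = exp (2 * \<i> * z)"
    "exp (- 2 * \<i> * (z + of_real pi)) = exp (- 2 * \<i> * z)"
    by (simp_all add: ring_distribs exp_add exp_diff mult_ac)
  then show ?thesis unfolding theta1_partial_theta by (simp add: algebra_simps)
qed

lemma exp_add_half_pi_tau:
  "exp (\<i> * (z + of_real pi * \<tau> / 2)) = exp (\<i> * z) * qpow \<tau> (1/4)"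
  "exp (- \<i> * (z + of_real pi * \<tau> / 2)) = exp (- \<i> * z) * qpow \<tau> (-1/4)"
  "exp (2 * \<i> * (z + of_real pi * \<tau> / 2)) = exp (2 * \<i> * z) * qpow \<tau> (1/2)"
  "exp (- 2 * \<i> * (z + of_real pi * \<tau> / 2)) = exp (- 2 * \<i> * z) * qpow \<tau> (-1/2)"
  unfolding qpow_def exp_add[symmetric] by (simp_all add: algebra_simps)

text \<open>One half is evaluated at q times its argument in \<open>theta4\<close>.
  \<open>partial_theta_shift\<close> moves it back, and the constant 1 in that rule accounts for the
  -1 in \<open>theta4_partial_theta\<close>.\<close>

lemma theta1_add_half_pi_tau:
  "theta1 (z + of_real pi * \<tau> / 2) \<tau> = \<i> * qpow \<tau> (-1/8) * exp (- \<i> * z) * theta4 z \<tau>"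
proof -
  let ?e = "exp (\<i> * z)" and ?e' = "exp (- \<i> * z)" and ?E = "exp (2 * \<i> * z)" and ?E' = "exp (- 2 * \<i> * z)"
  have a1: "- qpow \<tau> (1/2) * (?E * qpow \<tau> (1/2)) = qpow \<tau> 1 * (- ?E)"
    using qpow_add[of \<tau> "1/2" "1/2"] by simp
  have a2: "- qpow \<tau> (1/2) * (?E' * qpow \<tau> (-1/2)) = - ?E'"
    using qpow_add[of \<tau> "1/2" "-1/2"] by simp
  have b: "qpow \<tau> (1/8) * qpow \<tau> (1/4) = qpow \<tau> (-1/8) * qpow \<tau> (1/2)"
    "qpow \<tau> (1/8) * qpow \<tau> (-1/4) = qpow \<tau> (-1/8)"
    by (simp_all add: qpow_add[symmetric])
  have e: "?e' * ?E = ?e" by (simp add: exp_add[symmetric])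
  have T: "partial_theta \<tau> (- ?E) = 1 - qpow \<tau> (1/2) * ?E * partial_theta \<tau> (qpow \<tau> 1 * (- ?E))"
    using partial_theta_shift[of "- ?E"] by simp
  have "theta1 (z + of_real pi * \<tau> / 2) \<tau> =
     - \<i> * (qpow \<tau> (1/8) * qpow \<tau> (1/4)) * ?e * partial_theta \<tau> (qpow \<tau> 1 * (- ?E))
     + \<i> * (qpow \<tau> (1/8) * qpow \<tau> (-1/4)) * ?e' * partial_theta \<tau> (- ?E')"
    unfolding theta1_partial_theta exp_add_half_pi_tau a1 a2 by (simp add: algebra_simps)
  also have "\<dots> = \<i> * qpow \<tau> (-1/8) * ?e' * theta4 z \<tau>"
    unfolding theta4_partial_theta T b e[symmetric] by (simp add: algebra_simps)
  finally show ?thesis .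
qed

lemma theta4_add_half_pi_tau:
  "theta4 (z + of_real pi * \<tau> / 2) \<tau> = \<i> * qpow \<tau> (-1/8) * exp (- \<i> * z) * theta1 z \<tau>"
proof -
  let ?e = "exp (\<i> * z)" and ?e' = "exp (- \<i> * z)" and ?E = "exp (2 * \<i> * z)" and ?E' = "exp (- 2 * \<i> * z)"
  have e: "?E' = ?e' * ?e'" "?e' * ?e = 1" by (simp_all add: exp_add[symmetric] mult.assoc)
  have b: "qpow \<tau> (1/2) * qpow \<tau> (-1/2) = 1" "qpow \<tau> 1 * qpow \<tau> (-1/2) = qpow \<tau> (1/2)"
    "qpow \<tau> (-1/8) * qpow \<tau> (1/8) = 1"
    by (simp_all add: qpow_add[symmetric])
  have "partial_theta \<tau> (- (?E' * qpow \<tau> (-1/2))) =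
      1 + (qpow \<tau> (1/2) * qpow \<tau> (-1/2)) * (- ?E') * partial_theta \<tau> ((qpow \<tau> 1 * qpow \<tau> (-1/2)) * (- ?E'))"
    by (subst partial_theta_shift) (simp add: mult_ac)
  then have T: "partial_theta \<tau> (- (?E' * qpow \<tau> (-1/2))) = 1 - ?E' * partial_theta \<tau> (- qpow \<tau> (1/2) * ?E')"
    unfolding b by simp
  have T2: "partial_theta \<tau> (- (?E * qpow \<tau> (1/2))) = partial_theta \<tau> (- qpow \<tau> (1/2) * ?E)"
    by (simp add: mult.commute)
  have "\<i> * qpow \<tau> (-1/8) * ?e' * theta1 z \<tau> = (qpow \<tau> (-1/8) * qpow \<tau> (1/8)) *
     ((?e' * ?e) * partial_theta \<tau> (- qpow \<tau> (1/2) * ?E) - (?e' * ?e') * partial_theta \<tau> (- qpow \<tau> (1/2) * ?E'))"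
    unfolding theta1_partial_theta by (simp add: algebra_simps del: mult_minus_left mult_minus_right)
  also have "\<dots> = theta4 (z + of_real pi * \<tau> / 2) \<tau>"
    unfolding theta4_partial_theta exp_add_half_pi_tau T T2 b e(2) e(1)[symmetric] by simp
  finally show ?thesis by simp
qed

text \<open>Two half steps lead from \<open>theta1\<close> to \<open>theta4\<close> and
  back.\<close>

lemma theta1_add_pi_tau:
  "theta1 (z + of_real pi * \<tau>) \<tau> = - qpow \<tau> (-1/2) * exp (- 2 * \<i> * z) * theta1 z \<tau>"
proof -
  have b: "qpow \<tau> (-1/8) * qpow \<tau> (-1/4) * qpow \<tau> (-1/8) = qpow \<tau> (-1/2)"
    by (simp add: qpow_add[symmetric])
  have e: "exp (- \<i> * z) * exp (- \<i> * z) = exp (- 2 * \<i> * z)" by (simp add: exp_add[symmetric] mult.assoc)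
  have "theta1 (z + of_real pi * \<tau>) \<tau> = theta1 ((z + of_real pi * \<tau> / 2) + of_real pi * \<tau> / 2) \<tau>"
    by (simp add: algebra_simps)
  also have "\<dots> = - (qpow \<tau> (-1/8) * qpow \<tau> (-1/4) * qpow \<tau> (-1/8)) * (exp (- \<i> * z) * exp (- \<i> * z)) * theta1 z \<tau>"
    unfolding theta1_add_half_pi_tau theta4_add_half_pi_tau exp_add_half_pi_tau
    by (simp add: mult_ac)
  finally show ?thesis unfolding b e .
qed

lemma holomorphic_theta1: "(\<lambda>z. theta1 z \<tau>) holomorphic_on A"
  unfolding theta1_partial_theta
  by (intro holomorphic_intros entire_compose[OF holomorphic_partial_theta])

section \<open>The product for theta1 and the zeros of theta1\<close>

lemma theta_prod_add_pi: "theta_prod \<tau> (z + of_real pi) = - theta_prod \<tau> z"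
proof -
  have "exp (- \<i> * (z + of_real pi)) = - exp (- \<i> * z)"
    "exp (2 * \<i> * (z + of_real pi)) = exp (2 * \<i> * z)"
    "exp (- 2 * \<i> * (z + of_real pi)) = exp (- 2 * \<i> * z)"
    by (simp_all add: ring_distribs exp_add exp_diff mult_ac)
  then show ?thesis unfolding theta_prod_def by simp
qed

lemma theta_prod_add_pi_tau:
  "theta_prod \<tau> (z + of_real pi * \<tau>) = - qpow \<tau> (-1/2) * exp (- 2 * \<i> * z) * theta_prod \<tau> z"
proof -
  let ?q = "qpow \<tau> 1" let ?Q = "euler_fun ?q"
  let ?E = "exp (2 * \<i> * z)" and ?E' = "exp (- 2 * \<i> * z)"
  have 1: "exp (- \<i> * (z + of_real pi * \<tau>)) = qpow \<tau> (-1/2) * exp (- \<i> * z)"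
    "exp (2 * \<i> * (z + of_real pi * \<tau>)) = ?q * ?E"
    unfolding qpow_def exp_add[symmetric] by (simp_all add: algebra_simps)
  have 2: "?q * exp (- 2 * \<i> * (z + of_real pi * \<tau>)) = ?E'"
    unfolding qpow_def exp_add[symmetric] by (simp add: algebra_simps)
  have s: "?Q ?E = (1 - ?E) * ?Q (?q * ?E)" "?Q ?E' = (1 - ?E') * ?Q (?q * ?E')"
    by (rule euler_fun_shift[OF norm_qpow_1])+
  have E: "1 - ?E' = - ?E' * (1 - ?E)"
    by (simp add: algebra_simps exp_add[symmetric])
  show ?thesis unfolding theta_prod_def 1 2 s E by (simp only: mult_ac mult_minus_left mult_minus_right)
qed

text \<open>Isolates the zero at the origin in an explicit sine, so that it can be cancelled against
  that of \<open>theta1\<close>.\<close>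

lemma theta_prod_sin:
  "theta_prod \<tau> z = - 2 * \<i> * sin z * euler_fun (qpow \<tau> 1) (qpow \<tau> 1 * exp (2 * \<i> * z))
     * euler_fun (qpow \<tau> 1) (qpow \<tau> 1 * exp (- 2 * \<i> * z))"
proof -
  have "exp (- \<i> * z) * (1 - exp (2 * \<i> * z)) = - 2 * \<i> * sin z"
  proof -
    have "2 * \<i> * sin z = exp (\<i> * z) - exp (- (\<i> * z))" by (simp add: sin_exp_eq)
    then show ?thesis by (simp add: algebra_simps exp_add[symmetric])
  qed
  then show ?thesis
    unfolding theta_prod_def by (subst euler_fun_shift[OF norm_qpow_1]) (simp add: mult.assoc[symmetric])
qed

lemma holomorphic_theta_prod: "theta_prod \<tau> holomorphic_on A"
  unfolding theta_prod_def[abs_def]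
  by (intro holomorphic_intros entire_compose[OF holomorphic_euler_fun[OF norm_qpow_1]])

lemma theta_prod_eq_0D:
  assumes "theta_prod \<tau> z = 0"
  shows "z \<in> period_lattice \<tau>"
proof -
  let ?q = "qpow \<tau> 1"
  have "euler_fun ?q (exp (2 * \<i> * z)) = 0 \<or> euler_fun ?q (?q * exp (- 2 * \<i> * z)) = 0"
    using assms by (auto simp: theta_prod_def)
  \<comment> \<open>The first Euler factor yields shifts k >= 0. The second starts at q and yields
    the negative shifts -(k+1).\<close>
  then have "\<exists>k::int. z + of_int k * (of_real pi * \<tau>) \<in> {of_int m * of_real pi | m. True}"
  proof
    assume "euler_fun ?q (exp (2 * \<i> * z)) = 0"
    then obtain k where "?q ^ k * exp (2 * \<i> * z) = 1"
      by (rule euler_fun_eq_0D[OF norm_qpow_1])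
    moreover have "exp (2 * \<i> * (z + of_nat k * (of_real pi * \<tau>))) = ?q ^ k * exp (2 * \<i> * z)"
      unfolding qpow_power unfolding qpow_def exp_add[symmetric]
      by (rule arg_cong[of _ _ exp]) (simp add: algebra_simps)
    ultimately have "exp (2 * \<i> * (z + of_nat k * (of_real pi * \<tau>))) = exp 0" by simp
    then obtain n :: int where "2 * \<i> * (z + of_nat k * (of_real pi * \<tau>)) = of_real (of_int (2 * n) * pi) * \<i>"
      by (auto simp only: exp_eq add_0)
    then have "z + of_int (int k) * (of_real pi * \<tau>) = of_int n * of_real pi" by simp
    then show ?thesis by blast
  next
    assume "euler_fun ?q (?q * exp (- 2 * \<i> * z)) = 0"
    then obtain k where "?q ^ k * (?q * exp (- 2 * \<i> * z)) = 1"
      by (rule euler_fun_eq_0D[OF norm_qpow_1])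
    moreover have "exp (- 2 * \<i> * (z - of_nat (Suc k) * (of_real pi * \<tau>))) = ?q ^ k * (?q * exp (- 2 * \<i> * z))"
      unfolding qpow_power unfolding qpow_def exp_add[symmetric]
      by (rule arg_cong[of _ _ exp]) (simp add: algebra_simps)
    ultimately have "exp (- (2 * \<i> * (z - of_nat (Suc k) * (of_real pi * \<tau>)))) = 1"
      by (simp only: mult_minus_left)
    then have "exp (2 * \<i> * (z - of_nat (Suc k) * (of_real pi * \<tau>))) = exp 0"
      by (simp only: exp_minus inverse_eq_1_iff exp_zero)
    then obtain n :: int where "2 * \<i> * (z - of_nat (Suc k) * (of_real pi * \<tau>)) = of_real (of_int (2 * n) * pi) * \<i>"
      by (auto simp only: exp_eq add_0)
    then have "z - of_nat (Suc k) * (of_real pi * \<tau>) = of_int n * of_real pi"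
      by (simp del: of_nat_Suc)
    then have "z + of_int (- int (Suc k)) * (of_real pi * \<tau>) = of_int n * of_real pi" by (simp add: algebra_simps)
    then show ?thesis by blast
  qed
  then obtain k m :: int where "z + of_int k * (of_real pi * \<tau>) = of_int m * of_real pi" by auto
  then have "z = of_int m * of_real pi + of_int (- k) * (of_real pi * \<tau>)" by (simp add: algebra_simps)
  then show ?thesis unfolding period_lattice_def by blast
qed

lemma theta1_lattice:
  assumes "z \<in> period_lattice \<tau>"
  shows "theta1 z \<tau> = 0"
proof -
  have "theta1 (0 + z) \<tau> = 0 \<longleftrightarrow> theta1 0 \<tau> = 0"
    by (rule periodic_lattice[where F = "\<lambda>z. theta1 z \<tau> = 0", OF _ _ assms])
       (simp_all add: theta1_add_pi theta1_add_pi_tau)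
  then show ?thesis using theta1_minus[of 0] by simp
qed

end

text \<open>\<open>theta1\<close> and \<open>theta_prod\<close> have the same multipliers, so their
  quotient is elliptic. It can be singular only at lattice points, hence, by periodicity, only the
  origin needs inspection.\<close>

lemma theta1_zeros:
  assumes tau: "Im \<tau> > 0" and x: "theta1 x \<tau> \<noteq> 0"
  shows theta1_eq_0_iff: "theta1 z \<tau> = 0 \<longleftrightarrow> z \<in> period_lattice \<tau>"
    and theta1_deriv_0: "deriv (\<lambda>z. theta1 z \<tau>) 0 \<noteq> 0"
proof -
  let ?q = "qpow \<tau> 1"
  define F where "F z = theta1 z \<tau> / theta_prod \<tau> z" for z
  have per: "F (z + of_real pi) = F z" "F (z + of_real pi * \<tau>) = F z" for z
    by (simp_all add: F_def theta1_add_pi[OF tau] theta1_add_pi_tau[OF tau]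
         theta_prod_add_pi[OF tau] theta_prod_add_pi_tau[OF tau])
  obtain \<phi> where \<phi>: "\<phi> holomorphic_on UNIV" "\<And>z. theta1 z \<tau> = z * \<phi> z"
    using entire_odd_factor[OF holomorphic_theta1[OF tau] theta1_minus[OF tau]] by metis
  \<comment> \<open>The entire function sin z / z, used to split the factor z off the
    product.\<close>
  obtain \<sigma> where \<sigma>: "\<sigma> holomorphic_on UNIV" "\<And>z::complex. sin z = z * \<sigma> z"
    using entire_odd_factor[OF holomorphic_on_sin sin_minus] by metis
  have "deriv (sin :: complex \<Rightarrow> complex) 0 = 1"
    by (rule DERIV_imp_deriv) (auto intro!: derivative_eq_intros)
  then have \<sigma>0: "\<sigma> 0 = 1" using deriv_linear_factor[OF \<sigma>, of 0] by simp
  define D where "D z = - 2 * \<i> * \<sigma> z * euler_fun ?q (?q * exp (2 * \<i> * z))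
     * euler_fun ?q (?q * exp (- 2 * \<i> * z))" for z
  have D: "theta_prod \<tau> z = z * D z" for z
    unfolding theta_prod_sin[OF tau] D_def \<sigma>(2) by (simp add: mult_ac)
  have D_hol: "D holomorphic_on UNIV"
    unfolding D_def by (intro holomorphic_intros \<sigma>(1)
       entire_compose[OF holomorphic_euler_fun[OF norm_qpow_1[OF tau]]])
  \<comment> \<open>Needed for D(0) = -2i Q(q)^2 to be nonzero: a zero would force q^(k+1) =
    1.\<close>
  have "euler_fun ?q ?q \<noteq> 0"
  proof
    assume "euler_fun ?q ?q = 0"
    then obtain k where "?q ^ k * ?q = 1" by (rule euler_fun_eq_0D[OF norm_qpow_1[OF tau]])
    then have "norm ?q ^ Suc k = 1" by (metis norm_one norm_power power_Suc2)
    then show False using norm_qpow_1[OF tau]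
      by (metis norm_ge_zero order.irrefl power_Suc_le_self less_imp_le order.strict_trans1)
  qed
  then have D0: "D 0 \<noteq> 0" by (simp add: D_def \<sigma>0)
  have FD: "eventually (\<lambda>w. F w = \<phi> w / D w) (at 0)"
    by (auto simp: eventually_at_filter F_def \<phi>(2) D)
  have an: "(\<lambda>w. \<phi> w / D w) analytic_on {0}"
    using D0 by (intro analytic_on_divide entire_analytic \<phi>(1) D_hol) auto
  have F_an: "F analytic_on {z}" if "z \<notin> period_lattice \<tau>" for z
    unfolding F_def[abs_def] using theta_prod_eq_0D[OF tau, of z] that
    by (intro analytic_on_divide entire_analytic holomorphic_theta1[OF tau] holomorphic_theta_prod[OF tau]) auto
  have rem: "removable_at F z" for z
  proof (cases "z \<in> period_lattice \<tau>")
    case True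
    have "removable_at F 0" unfolding removable_at_def using an FD by blast
    moreover have "(\<lambda>u. F (u + z)) = F"
      using periodic_lattice[where F = F, OF per True] by blast
    ultimately show ?thesis using removable_at_shift[of F z 0] by simp
  qed (simp add: F_an analytic_imp_removable_at)
  obtain c where c: "\<And>z. F analytic_on {z} \<Longrightarrow> F z = c" "\<And>z. eventually (\<lambda>w. F w = c) (at z)"
    using elliptic_removable_imp_constant[OF tau per rem] by blast
  have xL: "x \<notin> period_lattice \<tau>" using x theta1_lattice[OF tau] by blast
  have "c \<noteq> 0" using c(1)[OF F_an[OF xL]] x theta_prod_eq_0D[OF tau] xL by (auto simp: F_def)
  show "theta1 z \<tau> = 0 \<longleftrightarrow> z \<in> period_lattice \<tau>"
    using c(1)[OF F_an, of z] \<open>c \<noteq> 0\<close> theta1_lattice[OF tau, of z]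
    by (cases "z \<in> period_lattice \<tau>") (auto simp: F_def)
  \<comment> \<open>The constant is also the limit at 0, so the derivative of \<open>theta1\<close>
    there is \<phi>(0) = c D(0).\<close>
  have "((\<lambda>w. \<phi> w / D w) \<longlongrightarrow> \<phi> 0 / D 0) (at 0)"
    using analytic_at_imp_isCont[OF an] by (rule isContD)
  moreover have "((\<lambda>w. \<phi> w / D w) \<longlongrightarrow> c) (at 0)"
    using c(2)[of 0] FD by (intro tendsto_eventually) (auto elim: eventually_elim2)
  ultimately have "\<phi> 0 / D 0 = c" by (intro tendsto_unique[of "at 0"]) auto
  then show "deriv (\<lambda>z. theta1 z \<tau>) 0 \<noteq> 0"
    using deriv_linear_factor[OF \<phi>, of 0] \<open>c \<noteq> 0\<close> by auto
qed

section \<open>Half periods and the elliptic quotient S\<close>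

definition half_period :: "complex \<Rightarrow> nat \<times> nat \<Rightarrow> complex" where
  "half_period \<tau> p = (of_nat (fst p) * of_real pi + of_nat (snd p) * (of_real pi * \<tau>)) / 2"

text \<open>pi and pi \<tau> are linearly independent over the reals. The use is that distinct half
  periods with indices 0 and 1 are incongruent, where sums may replace differences.\<close>

lemma lattice_half_period_sum:
  assumes "Im \<tau> > 0" "half_period \<tau> p + half_period \<tau> r \<in> period_lattice \<tau>"
  shows "even (fst p + fst r) \<and> even (snd p + snd r)"
proof -
  obtain m n where mn: "half_period \<tau> p + half_period \<tau> r = of_int m * of_real pi + of_int n * (of_real pi * \<tau>)"
    using assms(2) by (auto simp: period_lattice_def)
  have "Im (half_period \<tau> p + half_period \<tau> r) = Im (of_int m * of_real pi + of_int n * (of_real pi * \<tau>))"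
    by (simp only: mn)
  then have "(real (snd p + snd r) / 2) * (pi * Im \<tau>) = of_int n * (pi * Im \<tau>)"
    by (simp add: half_period_def field_simps)
  then have "real (snd p + snd r) / 2 = of_int n" using assms(1) by simp
  then have n: "real (snd p + snd r) = of_int (2 * n)" by simp
  have "Re (half_period \<tau> p + half_period \<tau> r) = Re (of_int m * of_real pi + of_int n * (of_real pi * \<tau>))"
    by (simp only: mn)
  then have "real (fst p + fst r) * pi + real (snd p + snd r) * (pi * Re \<tau>) = of_int (2 * m) * pi + of_int (2 * n) * (pi * Re \<tau>)"
    by (simp add: half_period_def field_simps)
  then have m: "real (fst p + fst r) = of_int (2 * m)" unfolding n by simp
  show ?thesis using n m
    by (metis dvd_triv_left even_of_nat of_int_eq_iff of_int_of_nat_eq)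
qed

lemma double_half_period: "half_period \<tau> p + half_period \<tau> p \<in> period_lattice \<tau>"
  unfolding period_lattice_def half_period_def
  by (intro CollectI exI[of _ "int (fst p)"] exI[of _ "int (snd p)"]) simp

text \<open>Division by 2 of both lattice coordinates: the remainders give the half period, the
  quotients the lattice vector.\<close>

lemma lattice_half_period_cases:
  assumes "2 * z \<in> period_lattice \<tau>"
  obtains p l where "p \<in> {..<2} \<times> {..<2}" "l \<in> period_lattice \<tau>" "z = half_period \<tau> p + l"
proof -
  obtain m n where mn: "2 * z = of_int m * of_real pi + of_int n * (of_real pi * \<tau>)"
    using assms by (auto simp: period_lattice_def)
  define l where "l = of_int (m div 2) * of_real pi + of_int (n div 2) * (of_real pi * \<tau>)"
  have i: "of_int k = (2 * of_int (k div 2) + of_nat (nat (k mod 2)) :: complex)" for k :: int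
  proof -
    have "of_nat (nat (k mod 2)) = (of_int (k mod 2) :: complex)" by simp
    then show ?thesis by (metis mult_div_mod_eq of_int_add of_int_mult of_int_numeral)
  qed
  show ?thesis
  proof (rule that[of "(nat (m mod 2), nat (n mod 2))" l])
    show "(nat (m mod 2), nat (n mod 2)) \<in> {..<2} \<times> {..<2}" by auto
    show "l \<in> period_lattice \<tau>" unfolding l_def period_lattice_def by blast
    have "2 * z = 2 * (half_period \<tau> (nat (m mod 2), nat (n mod 2)) + l)"
      unfolding mn unfolding half_period_def l_def i[of m] i[of n] by (simp add: algebra_simps)
    then show "z = half_period \<tau> (nat (m mod 2), nat (n mod 2)) + l"
      by (subst (asm) mult_cancel_left) simp
  qed
qed

definition theta_quot :: "complex \<Rightarrow> complex \<Rightarrow> complex" where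
  "theta_quot \<tau> z = theta1 (2 * z) \<tau> / theta1 z \<tau> ^ 4"

context
  fixes \<tau> :: complex
  assumes tau: "Im \<tau> > 0"
begin

lemma theta1_double_add_pi: "theta1 (2 * (z + of_real pi)) \<tau> = theta1 (2 * z) \<tau>"
  using theta1_add_pi[OF tau, of "2 * z"] theta1_add_pi[OF tau, of "2 * z + of_real pi"]
  by (simp add: algebra_simps)

text \<open>This multiplier is the fourth power of that of \<open>theta1\<close>, which makes S
  elliptic, and its square is that of f, which makes g elliptic.\<close>

lemma theta1_double_add_pi_tau:
  "theta1 (2 * (z + of_real pi * \<tau>)) \<tau> = qpow \<tau> (-2) * exp (- 8 * \<i> * z) * theta1 (2 * z) \<tau>"
proof -
  have e: "qpow \<tau> (-1/2) * exp (- 2 * \<i> * (2 * z + of_real pi * \<tau>)) * (qpow \<tau> (-1/2) * exp (- 2 * \<i> * (2 * z))) =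
     qpow \<tau> (-2) * exp (- 8 * \<i> * z)"
    unfolding qpow_def exp_add[symmetric] by (simp add: algebra_simps)
  have "theta1 (2 * (z + of_real pi * \<tau>)) \<tau> = theta1 (2 * z + of_real pi * \<tau> + of_real pi * \<tau>) \<tau>"
    by (simp add: algebra_simps)
  then show ?thesis
    unfolding theta1_add_pi_tau[OF tau] e[symmetric] by simp
qed

lemma theta_quot_minus: "theta_quot \<tau> (- z) = - theta_quot \<tau> z"
  by (simp add: theta_quot_def theta1_minus[OF tau])

lemma theta_quot_add_pi: "theta_quot \<tau> (z + of_real pi) = theta_quot \<tau> z"
  unfolding theta_quot_def theta1_double_add_pi theta1_add_pi[OF tau] by simp

lemma theta_quot_add_pi_tau: "theta_quot \<tau> (z + of_real pi * \<tau>) = theta_quot \<tau> z"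
proof -
  have "(- qpow \<tau> (-1/2) * exp (- 2 * \<i> * z)) ^ 4 = qpow \<tau> (-2) * exp (- 8 * \<i> * z)"
    unfolding power_mult_distrib power_minus[of "qpow _ _"] qpow_power exp_of_nat_mult[symmetric]
    by (simp add: mult.assoc)
  then show ?thesis
    unfolding theta_quot_def theta1_double_add_pi_tau theta1_add_pi_tau[OF tau] power_mult_distrib[of "_ * _" "theta1 _ _"]
    by simp
qed

lemma theta_quot_add_lattice: "l \<in> period_lattice \<tau> \<Longrightarrow> theta_quot \<tau> (z + l) = theta_quot \<tau> z"
  by (rule periodic_lattice[where F = "theta_quot \<tau>", OF theta_quot_add_pi theta_quot_add_pi_tau])

lemma holomorphic_theta1_double: "(\<lambda>z. theta1 (2 * z) \<tau>) holomorphic_on A"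
  by (rule entire_compose[OF holomorphic_theta1[OF tau]]) (intro holomorphic_intros)

lemma analytic_theta_quot:
  assumes "theta1 (z + w) \<tau> \<noteq> 0"
  shows "(\<lambda>u. theta_quot \<tau> (u + w)) analytic_on {z}"
  unfolding theta_quot_def using assms
  by (intro analytic_on_divide analytic_on_power entire_analytic entire_compose[OF holomorphic_theta1_double]
       entire_compose[OF holomorphic_theta1[OF tau]] holomorphic_intros) auto

text \<open>The exponential factors of numerator and denominator cancel. A sign remains from
  \<open>theta1\<close> at 2x for each of the steps pi/2 and pi \<tau> / 2, so both steps together
  leave none.\<close>

lemma theta_quot_half_periods:
  "theta_quot \<tau> (x + half_period \<tau> (0, 0)) = theta1 (2 * x) \<tau> / theta1 x \<tau> ^ 4"
  "theta_quot \<tau> (x + half_period \<tau> (1, 0)) = - theta1 (2 * x) \<tau> / theta2 x \<tau> ^ 4"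
  "theta_quot \<tau> (x + half_period \<tau> (0, 1)) = - theta1 (2 * x) \<tau> / theta4 x \<tau> ^ 4"
  "theta_quot \<tau> (x + half_period \<tau> (1, 1)) = theta1 (2 * x) \<tau> / theta3 x \<tau> ^ 4"
proof -
  show "theta_quot \<tau> (x + half_period \<tau> (0, 0)) = theta1 (2 * x) \<tau> / theta1 x \<tau> ^ 4"
    by (simp add: theta_quot_def half_period_def)
  show "theta_quot \<tau> (x + half_period \<tau> (1, 0)) = - theta1 (2 * x) \<tau> / theta2 x \<tau> ^ 4"
    using theta1_add_pi[OF tau, of "2 * x"]
    by (simp add: theta_quot_def half_period_def theta2_eq_theta1 ring_distribs)
  have 4: "theta_quot \<tau> (y + of_real pi * \<tau> / 2) = - theta1 (2 * y) \<tau> / theta4 y \<tau> ^ 4" for y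
  proof -
    have e: "(\<i> * qpow \<tau> (-1/8) * exp (- \<i> * y)) ^ 4 = qpow \<tau> (-1/2) * exp (- 2 * \<i> * (2 * y))"
      unfolding power_mult_distrib qpow_power exp_of_nat_mult[symmetric]
      by (simp add: mult_ac)
    have "theta1 (2 * (y + of_real pi * \<tau> / 2)) \<tau> = theta1 (2 * y + of_real pi * \<tau>) \<tau>"
      by (simp add: ring_distribs)
    then show ?thesis
      unfolding theta_quot_def theta1_add_half_pi_tau[OF tau] power_mult_distrib[of "_ * _" "theta4 _ _"] e
        theta1_add_pi_tau[OF tau] by simp
  qed
  show "theta_quot \<tau> (x + half_period \<tau> (0, 1)) = - theta1 (2 * x) \<tau> / theta4 x \<tau> ^ 4"
    using 4[of x] by (simp add: half_period_def)
  show "theta_quot \<tau> (x + half_period \<tau> (1, 1)) = theta1 (2 * x) \<tau> / theta3 x \<tau> ^ 4"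
    using 4[of "x + of_real pi / 2"] theta1_add_pi[OF tau, of "2 * x"]
    by (simp add: half_period_def theta3_eq_theta4 ring_distribs add_divide_distrib add_ac)
qed

end

section \<open>The identity for the logarithmic derivatives\<close>

theorem theorem7p3:
  fixes \<tau> x :: complex and f :: "complex \<Rightarrow> complex"
  assumes "Im \<tau> > 0"
    and "f holomorphic_on UNIV"
    and "\<And>z. f (- z) = f z"
    and "\<And>z. f z = f (z + of_real pi)"
    and "\<And>z. f z = qpow \<tau> 4 * exp (16 * \<i> * z) * f (z + of_real pi * \<tau>)"
    and "f x \<noteq> 0"
    and "theta1 (2 * x) \<tau> \<noteq> 0"
    and "theta1 x \<tau> \<noteq> 0" "theta2 x \<tau> \<noteq> 0" "theta3 x \<tau> \<noteq> 0" "theta4 x \<tau> \<noteq> 0"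
  shows "log_deriv f x - 4 * log_deriv (\<lambda>z. theta1 z \<tau>) (2 * x) =
    theta1_prime0 \<tau> * theta1 (2 * x) \<tau> ^ 3 / (4 * f x) *
      (- (f 0 / theta1 x \<tau> ^ 4)
       + f (of_real pi / 2) / theta2 x \<tau> ^ 4
       - qpow \<tau> 1 * f ((of_real pi + of_real pi * \<tau>) / 2) / theta3 x \<tau> ^ 4
       + qpow \<tau> 1 * f (of_real pi * \<tau> / 2) / theta4 x \<tau> ^ 4)"
proof -
  note tau = assms(1) and hol_f = assms(2) and even_f = assms(3)
  let ?\<theta> = "\<lambda>z. theta1 z \<tau>" and ?w = "half_period \<tau>" and ?S = "theta_quot \<tau>"
  let ?I = "{..<2::nat} \<times> {..<2::nat}"
  define a where "a = deriv ?\<theta> 0"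
  have zeros: "?\<theta> z = 0 \<longleftrightarrow> z \<in> period_lattice \<tau>" for z
    by (rule theta1_eq_0_iff[OF tau assms(8)])
  have a_nz: "a \<noteq> 0"
    unfolding a_def by (rule theta1_deriv_0[OF tau assms(8)])
  have f_pi: "f (z + of_real pi) = f z" for z using assms(4) by simp
  \<comment> \<open>The functional equation solved for the shifted value, as a square so that it
    matches the denominator of g.\<close>
  have f_pi_tau: "f (z + of_real pi * \<tau>) = (qpow \<tau> (-2) * exp (- 8 * \<i> * z))\<^sup>2 * f z" for z
  proof -
    have "(qpow \<tau> (-2) * exp (- 8 * \<i> * z))\<^sup>2 * (qpow \<tau> 4 * exp (16 * \<i> * z)) = 1"
      unfolding power2_eq_square qpow_def exp_add[symmetric] by (simp add: algebra_simps)
    then show ?thesis by (subst (2) assms(5)) (simp add: mult.assoc[symmetric])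
  qed

  define g where "g z = f z / (?\<theta> (2 * z))\<^sup>2" for z
  have g_per: "g (z + of_real pi) = g z" "g (z + of_real pi * \<tau>) = g z" for z
    unfolding g_def theta1_double_add_pi[OF tau] theta1_double_add_pi_tau[OF tau] f_pi f_pi_tau
    by (simp_all add: power_mult_distrib[of _ "theta1 _ _"])
  have g_even: "g (- z) = g z" for z
    by (simp add: g_def even_f theta1_minus[OF tau])
  have g_an: "g analytic_on {z}" if "2 * z \<notin> period_lattice \<tau>" for z
    unfolding g_def[abs_def] using that zeros
    by (intro analytic_on_divide analytic_on_power entire_analytic hol_f holomorphic_theta1_double[OF tau]) auto

  \<comment> \<open>The numerator of g near a half period, over the unshifted denominator. The
    factor q e^(8iu) is the inverse of the multiplier of \<theta>1(2u)^2; at u = 0 it becomes the q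
    of the theorem.\<close>
  define h where "h p u = (if snd p = 0 then 1 else qpow \<tau> 1 * exp (8 * \<i> * u)) * f (u + ?w p)" for p u
  have h_hol: "h p holomorphic_on UNIV" for p
  proof -
    have "(\<lambda>u. f (u + ?w p)) holomorphic_on UNIV"
      by (intro entire_compose[OF hol_f] holomorphic_intros)
    moreover have "(\<lambda>u. qpow \<tau> 1 * exp (8 * \<i> * u)) holomorphic_on UNIV"
      by (intro holomorphic_intros)
    ultimately show ?thesis
      unfolding h_def[abs_def] by (cases "snd p = 0") (simp_all add: holomorphic_on_mult)
  qed
  have g_h: "g (u + ?w p) = h p u / (?\<theta> (2 * u))\<^sup>2" if "p \<in> ?I" for p u
  proof -
    have eq: "2 * (u + ?w p) = 2 * u + of_nat (fst p) * of_real pi + of_nat (snd p) * (of_real pi * \<tau>)"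
      by (simp add: half_period_def field_simps)
    have 1: "(?\<theta> (2 * u + of_nat (fst p) * of_real pi))\<^sup>2 = (?\<theta> (2 * u))\<^sup>2"
      using that theta1_add_pi[OF tau, of "2 * u"] by (auto simp: less_2_cases_iff)
    have 2: "(?\<theta> (v + of_real pi * \<tau>))\<^sup>2 = (?\<theta> v)\<^sup>2 / (qpow \<tau> 1 * exp (4 * \<i> * v))" for v
    proof -
      have "(- qpow \<tau> (-1/2) * exp (- 2 * \<i> * v))\<^sup>2 * (qpow \<tau> 1 * exp (4 * \<i> * v)) = 1"
        unfolding power2_eq_square qpow_def by (simp add: exp_add[symmetric] algebra_simps)
      then show ?thesis
        unfolding theta1_add_pi_tau[OF tau] power_mult_distrib[of _ "theta1 _ _"]
        by (simp add: field_simps)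
    qed
    have 3: "exp (4 * \<i> * (2 * u + of_nat (fst p) * of_real pi)) = exp (8 * \<i> * u)"
    proof -
      have "4 * \<i> * (2 * u + of_nat (fst p) * of_real pi) =
          8 * \<i> * u + of_real (of_int (2 * (2 * int (fst p))) * pi) * \<i>" by (simp add: algebra_simps)
      then show ?thesis unfolding exp_eq by blast
    qed
    show ?thesis
    proof (cases "snd p = 0")
      case True
      then show ?thesis unfolding g_def eq h_def using 1 by simp
    next
      case False
      then have p: "snd p = 1" using that by auto
      show ?thesis unfolding g_def eq h_def p
        by (simp add: 2 1 3 mult.commute[of "f _"] flip: mult.assoc)
    qed
  qed
  \<comment> \<open>By evenness of f, f(-u + w) = f(u - w), and the period 2w leads back to f(u +
    w). The prefactor in \<open>h\<close> compensates the multiplier of f.\<close>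
  have h_even: "h p (- u) = h p u" if p_in: "p \<in> ?I" for p u
  proof -
    obtain i j where p: "p = (i, j)" "i < 2" "j < 2" using p_in by auto
    have v: "f (- u + ?w p) = f (u - ?w p)"
      using even_f[of "u - ?w p"] by simp
    have "f (u - ?w p) = f (u - ?w p + of_nat i * of_real pi)"
      using p f_pi by (auto simp: less_2_cases_iff)
    also have "u - ?w p + of_nat i * of_real pi = u + of_nat i * of_real pi / 2 - of_nat j * (of_real pi * \<tau>) / 2"
      by (simp add: p half_period_def field_simps)
    finally have v2: "f (- u + ?w p) = f (u + of_nat i * of_real pi / 2 - of_nat j * (of_real pi * \<tau>) / 2)"
      unfolding v .
    show ?thesis
    proof (cases "j = 0")
      case True
      then show ?thesis using v2 by (simp add: h_def p half_period_def)
    next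
      case False
      then have j: "j = 1" using p by auto
      let ?y = "u + of_nat i * of_real pi / 2 - of_real pi * \<tau> / 2"
      have "exp (8 * \<i> * (- u)) * (qpow \<tau> 4 * exp (16 * \<i> * ?y)) = exp (8 * \<i> * u)"
      proof -
        have "8 * \<i> * (- u) + (2 * of_real pi * \<i> * 4 * \<tau> + 16 * \<i> * ?y) =
          8 * \<i> * u + of_real (of_int (2 * (4 * int i)) * pi) * \<i>" by (simp add: field_simps)
        then show ?thesis unfolding qpow_def exp_add[symmetric] exp_eq by blast
      qed
      moreover have "f (- u + ?w p) = (qpow \<tau> 4 * exp (16 * \<i> * ?y)) * f (?y + of_real pi * \<tau>)"
        using v2 assms(5)[of ?y] by (simp add: j)
      moreover have "?y + of_real pi * \<tau> = u + ?w p"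
        by (simp add: p j half_period_def field_simps)
      ultimately show ?thesis
        by (simp add: h_def p j flip: mult.assoc)
    qed
  qed

  \<comment> \<open>The weights are those of \<open>removable_deriv_quotient\<close> at each half
    period: S(z + w) has its poles at the points congruent to -w, hence to w.\<close>
  define E where "E z = deriv g z + a / 4 * (\<Sum>p\<in>?I. h p 0 * ?S (z + ?w p))" for z
  have S_odd: "?S (- z + ?w p) = - ?S (z + ?w p)" for z p
    using theta_quot_add_lattice[OF tau double_half_period[of \<tau> p], of "z - ?w p"]
      theta_quot_minus[OF tau, of "z - ?w p"] by (simp add: add.commute)
  have S_an: "(\<lambda>z. ?S (z + ?w p)) analytic_on {z}" if "2 * z \<notin> period_lattice \<tau>" for z p
  proof (rule analytic_theta_quot[OF tau], unfold zeros, rule notI)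
    assume "z + ?w p \<in> period_lattice \<tau>"
    then obtain m n where mn: "z + ?w p = of_int m * of_real pi + of_int n * (of_real pi * \<tau>)"
      by (auto simp: period_lattice_def)
    have "2 * z = 2 * (z + ?w p) - 2 * ?w p" by simp
    also have "\<dots> = of_int (2 * m - int (fst p)) * of_real pi + of_int (2 * n - int (snd p)) * (of_real pi * \<tau>)"
      unfolding mn by (simp add: half_period_def field_simps)
    finally show False using that unfolding period_lattice_def by blast
  qed
  have E_an: "E analytic_on {z}" if "2 * z \<notin> period_lattice \<tau>" for z
    unfolding E_def[abs_def] using that
    by (intro analytic_on_add analytic_on_mult analytic_on_const analytic_on_sum S_an analytic_deriv g_an) auto
  have E_per: "E (z + of_real pi) = E z" "E (z + of_real pi * \<tau>) = E z" for z
  proof -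
    have d: "deriv g (z + of_real pi) = deriv g z" "deriv g (z + of_real pi * \<tau>) = deriv g z"
      by (simp_all only: deriv_shift g_per)
    have s: "?S (z + c + ?w p) = ?S (z + ?w p + c)" for c p by (simp add: add_ac)
    show "E (z + of_real pi) = E z" "E (z + of_real pi * \<tau>) = E z"
      unfolding E_def d s theta_quot_add_pi[OF tau] theta_quot_add_pi_tau[OF tau] by (rule refl)+
  qed
  have E_rem_half: "removable_at E (0 + ?w p)" if p: "p \<in> ?I" for p
  proof (rule removable_at_shift)
    \<comment> \<open>Only the summand \<open>r = p\<close> is singular at the half period of
      \<open>p\<close>, where it becomes S(u) by periodicity; it is paired with the derivative of
      g.\<close>
    have E_split: "E (u + ?w p) = (deriv (\<lambda>v. h p v / (?\<theta> (2 * v))\<^sup>2) u + deriv ?\<theta> 0 / 4 * h p 0 * (?\<theta> (2 * u) / ?\<theta> u ^ 4))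
         + a / 4 * (\<Sum>r\<in>?I - {p}. h r 0 * ?S (u + (?w p + ?w r)))" for u
    proof -
      have "?S (u + ?w p + ?w p) = ?\<theta> (2 * u) / ?\<theta> u ^ 4"
        using theta_quot_add_lattice[OF tau double_half_period[of \<tau> p], of u]
        by (simp add: add.assoc theta_quot_def)
      moreover have "deriv g (u + ?w p) = deriv (\<lambda>v. h p v / (?\<theta> (2 * v))\<^sup>2) u"
        unfolding deriv_shift g_h[OF p] by (rule refl)
      moreover have "(\<Sum>r\<in>?I. h r 0 * ?S (u + ?w p + ?w r)) = h p 0 * ?S (u + ?w p + ?w p)
          + (\<Sum>r\<in>?I - {p}. h r 0 * ?S (u + ?w p + ?w r))"
        using p by (intro sum.remove) auto
      ultimately show ?thesis
        unfolding E_def a_def by (simp add: ring_distribs add.assoc)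
    qed
    have "?\<theta> (0 + (?w p + ?w r)) \<noteq> 0" if "r \<in> ?I - {p}" for r
    proof
      assume "?\<theta> (0 + (?w p + ?w r)) = 0"
      then have "even (fst p + fst r) \<and> even (snd p + snd r)"
        using lattice_half_period_sum[OF tau] zeros by simp
      then show False using that p by (auto simp: less_2_cases_iff)
    qed
    then have "(\<lambda>u. a / 4 * (\<Sum>r\<in>?I - {p}. h r 0 * ?S (u + (?w p + ?w r)))) analytic_on {0}"
      by (intro analytic_on_mult analytic_on_const analytic_on_sum analytic_theta_quot[OF tau])
    then show "removable_at (\<lambda>u. E (u + ?w p)) 0"
      unfolding E_split
      using a_nz unfolding a_def
      by (intro removable_at_add analytic_imp_removable_at removable_deriv_quotient
            holomorphic_theta1[OF tau] theta1_minus[OF tau] h_hol h_even[OF p])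
  qed
  have E_rem: "removable_at E z" for z
  proof (cases "2 * z \<in> period_lattice \<tau>")
    case True
    then obtain p l where pl: "p \<in> ?I" "l \<in> period_lattice \<tau>" "z = ?w p + l"
      using lattice_half_period_cases by blast
    have "(\<lambda>u. E (u + l)) = E"
      using periodic_lattice[where F = E, OF E_per pl(2)] by blast
    then show ?thesis using removable_at_shift[of E l "?w p"] E_rem_half[OF pl(1)] pl(3) by simp
  qed (simp add: E_an analytic_imp_removable_at)
  obtain c where c: "\<And>z. E analytic_on {z} \<Longrightarrow> E z = c"
    using elliptic_removable_imp_constant[OF tau E_per E_rem] by metis

  \<comment> \<open>Both x and -x are regular points of \<open>E\<close>, so the constant satisfies
    c = E(-x) = -E(x) = -c.\<close>
  have x2: "2 * x \<notin> period_lattice \<tau>" "2 * (- x) \<notin> period_lattice \<tau>"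
    using assms(7) zeros[of "2 * x"] zeros[of "2 * (- x)"] theta1_minus[OF tau, of "2 * x"] by auto
  have "deriv g (- x) = - deriv g x"
  proof -
    have "(g has_field_derivative deriv g (- x)) (at (- x))"
      using analytic_on_imp_differentiable_at[OF g_an[OF x2(2)], of "-x"]
      by (simp add: field_differentiable_derivI)
    then have "((\<lambda>z. g (- z)) has_field_derivative deriv g (- x) * (- 1)) (at x)"
      by (rule DERIV_chain2) (auto intro!: derivative_eq_intros)
    then show ?thesis by (simp add: g_even DERIV_imp_deriv)
  qed
  then have "E (- x) = - E x"
    unfolding E_def S_odd by (simp add: sum_negf)
  moreover have "E x = c" "E (- x) = c" using c E_an x2 by blast+
  ultimately have "E x = 0" by simp

  have dg: "deriv g x = (deriv f x * (?\<theta> (2 * x))\<^sup>2 - f x * (4 * ?\<theta> (2 * x) * deriv ?\<theta> (2 * x))) / ?\<theta> (2 * x) ^ 4"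
    unfolding g_def[abs_def]
    by (rule deriv_quotient_double_square[OF holomorphic_theta1[OF tau] hol_f assms(7)])
  have I: "?I = {(0, 0), (1, 0), (0, 1), (1, 1)}" by (auto simp: less_2_cases_iff)
  have h0: "h (0, 0) 0 = f 0" "h (1, 0) 0 = f (of_real pi / 2)"
    "h (0, 1) 0 = qpow \<tau> 1 * f (of_real pi * \<tau> / 2)"
    "h (1, 1) 0 = qpow \<tau> 1 * f ((of_real pi + of_real pi * \<tau>) / 2)"
    by (simp_all add: h_def half_period_def)
  let ?R = "- (f 0 / theta1 x \<tau> ^ 4)
       + f (of_real pi / 2) / theta2 x \<tau> ^ 4
       - qpow \<tau> 1 * f ((of_real pi + of_real pi * \<tau>) / 2) / theta3 x \<tau> ^ 4
       + qpow \<tau> 1 * f (of_real pi * \<tau> / 2) / theta4 x \<tau> ^ 4"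
  have "(\<Sum>p\<in>?I. h p 0 * ?S (x + ?w p)) = - (?\<theta> (2 * x) * ?R)"
    unfolding I by (simp add: h0 theta_quot_half_periods[OF tau] ring_distribs mult_ac del: One_nat_def)
  then have dg': "deriv g x = a / 4 * ?\<theta> (2 * x) * ?R"
    using \<open>E x = 0\<close> unfolding E_def by (simp add: add_eq_0_iff mult.assoc)
  \<comment> \<open>The left-hand side is g'/g at x. Multiplying g' by 1/g = \<theta>1(2x)^2 / f(x)
    makes the cube of \<theta>1(2x) in the result.\<close>
  have "log_deriv f x - 4 * log_deriv ?\<theta> (2 * x) = (?\<theta> (2 * x))\<^sup>2 / f x * deriv g x"
    unfolding dg log_deriv_def using assms(6,7)
    by (simp add: field_simps power2_eq_square power4_eq_xxxx)
  also have "\<dots> = theta1_prime0 \<tau> * theta1 (2 * x) \<tau> ^ 3 / (4 * f x) * ?R"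
    unfolding dg' theta1_prime0_def a_def by (simp add: power2_eq_square power3_eq_cube mult_ac)
  finally show ?thesis .
qed

end
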